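(* (Robertson–Schrödinger uncertainty relation.) Let $(M,\omega)$ be a symplectic manifold with a star product $*$ on $C^\infty(M)((\hbar^{\mathbb{Q}}))$, let $\rho:C^{\infty}(M)((\hbar^{\mathbb{Q}}))\to\mathbb{C}((\hbar^{\mathbb{Q}}))$ be a state, and let $X_1,\dots,X_n\in C^{\infty}(M)((\hbar^{\mathbb{Q}}))$ satisfy $\overline{X_j}=X_j$ for $j=1,\dots,n$. Put $\delta X_j:=X_j-\rho(X_j)$. Then, in the ordered field $\mathbb{R}((\hbar^{\mathbb{Q}}))$, $$\det\Big(\tfrac12\rho(\delta X_j*\delta X_k+\delta X_k*\delta X_j)\Big)_{j,k=1}^n\ \ge\ \det\Big(\tfrac{\hbar}{2}\rho(\{X_j,X_k\}_* )\Big)_{j,k=1}^n ,$$ where $\{X_j,X_k\}_*:=\frac{1}{i\hbar}(X_j*X_k-X_k*X_j)$.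
   Context: For a field $\mathbb{K}$, $\mathbb{K}((\hbar^{\mathbb{Q}}))$ is the field of formal series $a=\sum_{q\in\mathbb{Q}}a_q\hbar^q$, $a_q\in\mathbb{K}$, whose support $\{q:a_q\neq0\}$ is well-ordered (every nonempty subset has a least element), with the usual addition and product. $\mathbb{R}((\hbar^{\mathbb{Q}}))$ is ordered by: $a>0$ iff $a\ne 0$ and $a_{q_0}>0$, where $q_0=\min\operatorname{supp}a$. $\mathbb{C}((\hbar^{\mathbb{Q}}))=\mathbb{R}((\hbar^{\mathbb{Q}}))+i\,\mathbb{R}((\hbar^{\mathbb{Q}}))$. $C^\infty(M)((\hbar^{\mathbb{Q}}))$ is the $\mathbb{C}((\hbar^{\mathbb{Q}}))$-vector space of such series with coefficients in the complex-valued smooth functions on $M$. The overbar denotes coefficientwise complex conjugation ($\hbar$ is real). A star product is an associative $\mathbb{C}((\hbar^{\mathbb{Q}}))$-bilinear product of the form $f*g=\sum_{k=0}^\infty C_k(f,g)\hbar^k$, where the $C_k$ are bidifferential operators (acting coefficientwise) mapping $C^\infty(M)\times C^\infty(M)$ to $C^\infty(M)$, with $C_0(f,g)=fg$, $C_k(1,f)=C_k(f,1)=0$ for $k\ge1$, and $C_1(f,g)-C_1(g,f)=i\{f,g\}$, where $\{\cdot,\cdot\}$ is the Poisson bracket of $(M,\omega)$. A $\mathbb{C}((\hbar^{\mathbb{Q}}))$-linear functional $\rho:C^\infty(M)((\hbar^{\mathbb{Q}}))\to\mathbb{C}((\hbar^{\mathbb{Q}}))$ is positive if $\rho(\overline f*f)\ge0$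 (in particular lies in $\mathbb{R}((\hbar^{\mathbb{Q}}))$) for all $f$; it is a state if moreover $\rho(1)=1$. *)

theory Defs
  imports
    "HOL-Analysis.Analysis"
    "HOL-Library.Function_Algebras"
    "Jordan_Normal_Form.Determinant"
begin

section \<open>Formal series with well-ordered rational support\<close>

definition well_ordered_set :: "'a::linorder set \<Rightarrow> bool" where
  "well_ordered_set S \<longleftrightarrow> (\<forall>T. T \<subseteq> S \<and> T \<noteq> {} \<longrightarrow> (\<exists>m\<in>T. \<forall>x\<in>T. m \<le> x))"

lemma well_ordered_setD:
  "well_ordered_set S \<Longrightarrow> T \<subseteq> S \<Longrightarrow> T \<noteq> {} \<Longrightarrow> \<exists>m\<in>T. \<forall>x\<in>T. m \<le> x"
  by (auto simp: well_ordered_set_def)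

lemma well_ordered_set_subset: "well_ordered_set S \<Longrightarrow> T \<subseteq> S \<Longrightarrow> well_ordered_set T"
  unfolding well_ordered_set_def by (meson subset_trans)

lemma well_ordered_set_finite: assumes "finite S" shows "well_ordered_set S"
  unfolding well_ordered_set_def
proof (intro allI impI, elim conjE)
  fix T assume T: "T \<subseteq> S" "T \<noteq> {}"
  then have "finite T" using assms finite_subset by blast
  then show "\<exists>m\<in>T. \<forall>x\<in>T. m \<le> x" using T by (intro bexI[of _ "Min T"]) auto
qed

lemma well_ordered_set_Un:
  assumes "well_ordered_set S" "well_ordered_set S'"
  shows "well_ordered_set (S \<union> S')"
  unfolding well_ordered_set_def
proof (intro allI impI, elim conjE)
  fix T assume T: "T \<subseteq> S \<union> S'" "T \<noteq> {}"
  show "\<exists>m\<in>T. \<forall>x\<in>T. m \<le> x"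
  proof (cases "T \<inter> S = {} \<or> T \<inter> S' = {}")
    case True
    then have "T \<subseteq> S' \<or> T \<subseteq> S" using T by auto
    then show ?thesis using T assms by (auto dest: well_ordered_setD)
  next
    case False
    obtain m where m: "m \<in> T \<inter> S" "\<forall>x\<in>T \<inter> S. m \<le> x"
      using well_ordered_setD[OF assms(1), of "T \<inter> S"] False by auto
    obtain m' where m': "m' \<in> T \<inter> S'" "\<forall>x\<in>T \<inter> S'. m' \<le> x"
      using well_ordered_setD[OF assms(2), of "T \<inter> S'"] False by auto
    have "min m m' \<in> T" using m m' by (auto simp: min_def)
    moreover have "\<forall>x\<in>T. min m m' \<le> x" using m m' T(1) by (fastforce simp: min_le_iff_disj)
    ultimately show ?thesis by blast
  qed
qed

lemma finite_if_Min_Max: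
  fixes S :: "'a::linorder set"
  assumes wo: "well_ordered_set S"
    and mx: "\<And>T. T \<subseteq> S \<Longrightarrow> T \<noteq> {} \<Longrightarrow> \<exists>m\<in>T. \<forall>x\<in>T. x \<le> m"
  shows "finite S"
proof (cases "S = {}")
  case False
  define T where "T = {x\<in>S. finite {y\<in>S. y \<le> x}}"
  obtain m0 where m0: "m0 \<in> S" "\<forall>x\<in>S. m0 \<le> x" using well_ordered_setD[OF wo, of S] False by auto
  have "{y\<in>S. y \<le> m0} \<subseteq> {m0}" using m0 by (auto intro: antisym)
  then have "m0 \<in> T" unfolding T_def using m0 finite_subset by auto
  then obtain m where m: "m \<in> T" "\<forall>x\<in>T. x \<le> m" using mx[of T] by (auto simp: T_def)
  have "{y\<in>S. m < y} = {}"
  proof (rule ccontr)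
    assume "{y\<in>S. m < y} \<noteq> {}"
    then obtain m' where m': "m' \<in> S" "m < m'" "\<forall>x\<in>S. m < x \<longrightarrow> m' \<le> x"
      using well_ordered_setD[OF wo, of "{y\<in>S. m < y}"] by auto
    have "{y\<in>S. y \<le> m'} \<subseteq> insert m' {y\<in>S. y \<le> m}" using m' by (force simp: not_le)
    moreover have "finite {y\<in>S. y \<le> m}" using m by (auto simp: T_def)
    ultimately have "finite {y\<in>S. y \<le> m'}" using finite_subset by blast
    then have "m' \<in> T" using m' by (auto simp: T_def)
    then show False using m m' by auto
  qed
  then have "S \<subseteq> {y\<in>S. y \<le> m}" by (auto simp: not_less)
  then show ?thesis using m finite_subset by (auto simp: T_def)
qed auto

lemma finite_decomp:
  fixes A B :: "rat set"
  assumes "well_ordered_set A" "well_ordered_set B"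
  shows "finite {p\<in>A. q - p \<in> B}"
proof (rule finite_if_Min_Max)
  show "well_ordered_set {p\<in>A. q - p \<in> B}"
    using assms(1) by (rule well_ordered_set_subset) auto
  fix T assume T: "T \<subseteq> {p\<in>A. q - p \<in> B}" "T \<noteq> {}"
  then obtain m where m: "m \<in> (\<lambda>p. q - p) ` T" "\<forall>x\<in>(\<lambda>p. q - p) ` T. m \<le> x"
    using well_ordered_setD[OF assms(2), of "(\<lambda>p. q - p) ` T"] by blast
  then obtain p where "p \<in> T" "m = q - p" by auto
  moreover have "x \<le> p" if "x \<in> T" for x
    using m(2) that \<open>m = q - p\<close> by fastforce
  ultimately show "\<exists>m\<in>T. \<forall>x\<in>T. x \<le> m" by blast
qed

definition set_sum :: "rat set \<Rightarrow> rat set \<Rightarrow> rat set" where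
  "set_sum A B = {p + r |p r. p \<in> A \<and> r \<in> B}"

lemma set_sumI: "p \<in> A \<Longrightarrow> q - p \<in> B \<Longrightarrow> q \<in> set_sum A B"
  unfolding set_sum_def by (intro CollectI exI[of _ p] exI[of _ "q - p"]) simp

lemma well_ordered_set_sum:
  assumes A: "well_ordered_set A" and B: "well_ordered_set B"
  shows "well_ordered_set (set_sum A B)"
  unfolding well_ordered_set_def
proof (intro allI impI, elim conjE)
  fix S assume S: "S \<subseteq> set_sum A B" "S \<noteq> {}"
  define R where "R = (\<lambda>p r. p \<in> A \<and> r \<in> B \<and> p + r \<in> S)"
  define K where "K = (\<lambda>p r. R p r \<and> (\<forall>p' r'. R p' r' \<and> p' \<le> p \<and> r' \<le> r \<longrightarrow> p' = p \<and> r' = r))"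
  have below: "\<exists>p' r'. K p' r' \<and> p' \<le> p \<and> r' \<le> r" if R: "R p r" for p r
  proof -
    let ?P = "{p'. p' \<le> p \<and> (\<exists>r'\<le>r. R p' r')}"
    obtain p' where p': "p' \<in> ?P" "\<forall>x\<in>?P. p' \<le> x"
      using well_ordered_setD[OF A, of ?P] R unfolding R_def by blast
    let ?Q = "{r'. r' \<le> r \<and> R p' r'}"
    obtain r' where r': "r' \<in> ?Q" "\<forall>x\<in>?Q. r' \<le> x"
      using well_ordered_setD[OF B, of ?Q] p' unfolding R_def by blast
    have "K p' r'"
      unfolding K_def
    proof (intro conjI allI impI)
      show "R p' r'" using r' by simp
      fix p2 r2 assume *: "R p2 r2 \<and> p2 \<le> p' \<and> r2 \<le> r'"
      then have "p2 \<le> p" "r2 \<le> r" using p' r' by auto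
      then have "p2 \<in> ?P" using * by blast
      then show p2: "p2 = p'" using p'(2) * by (meson antisym)
      have "r2 \<in> ?Q" using * p2 \<open>r2 \<le> r\<close> by auto
      then show "r2 = r'" using r'(2) * by (meson antisym)
    qed
    then show ?thesis using p' r' by auto
  qed
  have mono: "r' < r" if "K p r" "K p' r'" "p < p'" for p r p' r'
  proof (rule ccontr)
    assume "\<not> r' < r"
    then have "r \<le> r'" by simp
    then have "p = p'" using that unfolding K_def by (meson less_imp_le)
    then show False using that by simp
  qed
  have uniq: "r' = r" if "K p r" "K p r'" for p r r'
  proof (cases "r \<le> r'")
    case True then show ?thesis using that unfolding K_def by (metis order_refl)
  next
    case False then show ?thesis using that unfolding K_def by (metis order_refl linear)
  qed
  let ?M = "{p. \<exists>r. K p r}"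
  have finM: "finite ?M"
  proof (rule finite_if_Min_Max)
    show "well_ordered_set ?M"
      using A by (rule well_ordered_set_subset) (auto simp: K_def R_def)
    fix T assume T: "T \<subseteq> ?M" "T \<noteq> {}"
    let ?Q = "{r. \<exists>p\<in>T. K p r}"
    have "?Q \<noteq> {}" using T by blast
    moreover have "?Q \<subseteq> B" by (auto simp: K_def R_def)
    ultimately obtain m where m: "m \<in> ?Q" "\<forall>x\<in>?Q. m \<le> x"
      using well_ordered_setD[OF B, of ?Q] by blast
    then obtain p where p: "p \<in> T" "K p m" by auto
    have "x \<le> p" if "x \<in> T" for x
    proof (rule ccontr)
      assume "\<not> x \<le> p"
      moreover from T that have "\<exists>r. K x r" by blast
      then obtain r where "K x r" ..
      ultimately have "r < m" "r \<in> ?Q" using mono p that by (auto simp: not_le)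
      then show False using m by auto
    qed
    then show "\<exists>m\<in>T. \<forall>x\<in>T. x \<le> m" using p by auto
  qed
  define F where "F = {p + r |p r. K p r}"
  have "F \<subseteq> (\<lambda>p. p + (THE r. K p r)) ` ?M"
  proof
    fix s assume "s \<in> F"
    then obtain p r where pr: "s = p + r" "K p r" by (auto simp: F_def)
    then have "(THE r. K p r) = r" by (intro the_equality) (auto dest: uniq)
    then show "s \<in> (\<lambda>p. p + (THE r. K p r)) ` ?M" using pr by auto
  qed
  then have finF: "finite F" using finM finite_surj by blast
  obtain s where s: "s \<in> S" using S by auto
  then have "s \<in> set_sum A B" using S by blast
  then obtain p r where "R p r" using s by (auto simp: R_def set_sum_def)
  then have F_ne: "F \<noteq> {}" using below by (fastforce simp: F_def)
  have "Min F \<in> F" using finF F_ne by simp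
  then have "Min F \<in> S" by (auto simp: F_def K_def R_def)
  moreover have "Min F \<le> x" if "x \<in> S" for x
  proof -
    have "x \<in> set_sum A B" using S that by blast
    then obtain p r where pr: "x = p + r" "p \<in> A" "r \<in> B"
      by (auto simp: set_sum_def)
    with that have R: "R p r" by (simp add: R_def)
    obtain p' r' where K: "K p' r'" "p' \<le> p" "r' \<le> r" using below[OF R] by auto
    then have "Min F \<le> p' + r'" using finF by (intro Min_le) (auto simp: F_def)
    then show ?thesis using K pr by linarith
  qed
  ultimately show "\<exists>m\<in>S. \<forall>x\<in>S. m \<le> x" by blast
qed

typedef (overloaded) 'a hahn = "{f :: rat \<Rightarrow> 'a::zero. well_ordered_set {q. f q \<noteq> 0}}"
  morphisms hcoeff Abs_hahn
  by (intro exI[of _ "\<lambda>_. 0"]) (auto intro: well_ordered_set_finite)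

setup_lifting type_definition_hahn

definition hsupp :: "'a::zero hahn \<Rightarrow> rat set" where
  "hsupp f = {q. hcoeff f q \<noteq> 0}"

lemma well_ordered_hsupp: "well_ordered_set (hsupp f)"
  using hcoeff[of f] by (simp add: hsupp_def)

lemma hahn_eqI: "(\<And>q. hcoeff f q = hcoeff g q) \<Longrightarrow> f = g"
  by (simp add: hcoeff_inject[symmetric] fun_eq_iff)

text \<open>The monomial \<open>a \<hbar>\<^sup>q\<close>.\<close>

lift_definition hmonom :: "rat \<Rightarrow> 'a::zero \<Rightarrow> 'a hahn" is "\<lambda>q a r. if r = q then a else 0"
  by (auto intro: well_ordered_set_finite)

text \<open>Coefficientwise application of \<open>h\<close>; the case distinction is void for the maps with
  \<open>h 0 = 0\<close> to which it is applied below.\<close>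

lift_definition hmap :: "('a::zero \<Rightarrow> 'b::zero) \<Rightarrow> 'a hahn \<Rightarrow> 'b hahn" is
  "\<lambda>h f q. if f q = 0 then 0 else h (f q)"
  by (erule well_ordered_set_subset) auto

text \<open>Extension of a biadditive operation \<open>B\<close> to series, bilinear over series:
  \<open>(\<Sum>\<^sub>p f\<^sub>p \<hbar>\<^sup>p, \<Sum>\<^sub>r g\<^sub>r \<hbar>\<^sup>r) \<mapsto> \<Sum>\<^sub>q (\<Sum>\<^bsub>p+r=q\<^esub> B f\<^sub>p g\<^sub>r) \<hbar>\<^sup>q\<close>.
  The inner sums are finite by \<open>finite_decomp\<close>.\<close>

lift_definition hconv :: "('a::zero \<Rightarrow> 'b::zero \<Rightarrow> 'c::comm_monoid_add) \<Rightarrow> 'a hahn \<Rightarrow> 'b hahn \<Rightarrow> 'c hahn" is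
  "\<lambda>B f g q. \<Sum>p | f p \<noteq> 0 \<and> g (q - p) \<noteq> 0. B (f p) (g (q - p))"
proof -
  fix B :: "'a \<Rightarrow> 'b \<Rightarrow> 'c" and f :: "rat \<Rightarrow> 'a" and g :: "rat \<Rightarrow> 'b"
  assume *: "well_ordered_set {q. f q \<noteq> 0}" "well_ordered_set {q. g q \<noteq> 0}"
  have "{q. (\<Sum>p | f p \<noteq> 0 \<and> g (q - p) \<noteq> 0. B (f p) (g (q - p))) \<noteq> 0}
      \<subseteq> set_sum {q. f q \<noteq> 0} {q. g q \<noteq> 0}"
  proof
    fix q assume "q \<in> {q. (\<Sum>p | f p \<noteq> 0 \<and> g (q - p) \<noteq> 0. B (f p) (g (q - p))) \<noteq> 0}"
    then have "{p. f p \<noteq> 0 \<and> g (q - p) \<noteq> 0} \<noteq> {}" by (metis (mono_tags, lifting) mem_Collect_eq sum.empty)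
    then obtain p where "f p \<noteq> 0" "g (q - p) \<noteq> 0" by auto
    then show "q \<in> set_sum {q. f q \<noteq> 0} {q. g q \<noteq> 0}"
      by (auto intro: set_sumI)
  qed
  then show "well_ordered_set {q. (\<Sum>p | f p \<noteq> 0 \<and> g (q - p) \<noteq> 0. B (f p) (g (q - p))) \<noteq> 0}"
    using well_ordered_set_sum[OF *] well_ordered_set_subset by blast
qed

lemma hcoeff_hconv:
  assumes "well_ordered_set A" "well_ordered_set D" "hsupp f \<subseteq> A" "hsupp g \<subseteq> D"
    and "\<And>x. B 0 x = 0" "\<And>x. B x 0 = 0"
  shows "hcoeff (hconv B f g) q = (\<Sum>p | p \<in> A \<and> q - p \<in> D. B (hcoeff f p) (hcoeff g (q - p)))"
proof -
  have "finite {p. p \<in> A \<and> q - p \<in> D}" using finite_decomp[OF assms(1,2)] by simp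
  then show ?thesis unfolding hconv.rep_eq
    by (rule sum.mono_neutral_left) (use assms in \<open>auto simp: hsupp_def\<close>)
qed

lemma hsupp_hconv: "hsupp (hconv B f g) \<subseteq> set_sum (hsupp f) (hsupp g)"
proof
  fix q assume "q \<in> hsupp (hconv B f g)"
  then have "{p. hcoeff f p \<noteq> 0 \<and> hcoeff g (q - p) \<noteq> 0} \<noteq> {}"
    unfolding hsupp_def hconv.rep_eq by (metis (mono_tags, lifting) mem_Collect_eq sum.empty)
  then obtain p where "hcoeff f p \<noteq> 0" "hcoeff g (q - p) \<noteq> 0" by auto
  then show "q \<in> set_sum (hsupp f) (hsupp g)"
    by (auto simp: hsupp_def intro: set_sumI)
qed

subsection \<open>Ring structure\<close>

instantiation hahn :: (zero) zero
begin
lift_definition zero_hahn :: "'a hahn" is "\<lambda>_. 0" by (auto intro: well_ordered_set_finite)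
instance ..
end

instantiation hahn :: (zero_neq_one) one
begin
definition one_hahn :: "'a hahn" where "1 = hmonom 0 1"
instance ..
end

instantiation hahn :: (comm_monoid_add) comm_monoid_add
begin
lift_definition plus_hahn :: "'a hahn \<Rightarrow> 'a hahn \<Rightarrow> 'a hahn" is "\<lambda>f g q. f q + g q"
  by (rule well_ordered_set_subset[OF well_ordered_set_Un], assumption, assumption) auto
instance by standard (transfer; simp add: ac_simps fun_eq_iff)+
end

instantiation hahn :: (ab_group_add) ab_group_add
begin
lift_definition uminus_hahn :: "'a hahn \<Rightarrow> 'a hahn" is "\<lambda>f q. - f q" by simp
lift_definition minus_hahn :: "'a hahn \<Rightarrow> 'a hahn \<Rightarrow> 'a hahn" is "\<lambda>f g q. f q - g q"
  by (rule well_ordered_set_subset[OF well_ordered_set_Un], assumption, assumption) auto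
instance by standard (transfer; simp add: fun_eq_iff)+
end

lemma hsupp_plus: "hsupp (f + g) \<subseteq> hsupp f \<union> hsupp g"
  by (auto simp: hsupp_def plus_hahn.rep_eq)

lemma hsupp_monom: "hsupp (hmonom q a) \<subseteq> {q}"
  by (auto simp: hsupp_def hmonom.rep_eq split: if_splits)

instantiation hahn :: (comm_ring_1) comm_ring_1
begin

definition times_hahn :: "'a hahn \<Rightarrow> 'a hahn \<Rightarrow> 'a hahn" where
  "times_hahn = hconv (*)"

lemma hcoeff_times:
  fixes f g :: "'a hahn"
  assumes "well_ordered_set A" "well_ordered_set D" "hsupp f \<subseteq> A" "hsupp g \<subseteq> D"
  shows "hcoeff (f * g) q = (\<Sum>p | p \<in> A \<and> q - p \<in> D. hcoeff f p * hcoeff g (q - p))"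
  unfolding times_hahn_def by (rule hcoeff_hconv[OF assms]) auto

instance
proof
  fix a b c :: "'a hahn"
  note wo = well_ordered_hsupp well_ordered_set_sum well_ordered_set_Un
  show "a * b = b * a"
  proof (rule hahn_eqI)
    fix q
    show "hcoeff (a * b) q = hcoeff (b * a) q"
      unfolding times_hahn_def hconv.rep_eq
      by (rule sum.reindex_bij_witness[of _ "\<lambda>p. q - p" "\<lambda>p. q - p"]) (auto simp: mult.commute)
  qed
  show "a * b * c = a * (b * c)"
  proof (rule hahn_eqI)
    fix q
    let ?A = "hsupp a" and ?B = "hsupp b" and ?C = "hsupp c"
    let ?AB = "set_sum ?A ?B" and ?BC = "set_sum ?B ?C"
    let ?f = "\<lambda>p r. hcoeff a p * hcoeff b r * hcoeff c (q - p - r)"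
    have "hcoeff (a * b * c) q = (\<Sum>s | s \<in> ?AB \<and> q - s \<in> ?C. hcoeff (a * b) s * hcoeff c (q - s))"
      by (rule hcoeff_times) (auto simp: wo times_hahn_def hsupp_hconv[THEN subsetD])
    also have "\<dots> = (\<Sum>s | s \<in> ?AB \<and> q - s \<in> ?C. \<Sum>p | p \<in> ?A \<and> s - p \<in> ?B.
        hcoeff a p * hcoeff b (s - p) * hcoeff c (q - s))"
      by (subst hcoeff_times[where A = ?A and D = ?B]) (auto simp: wo sum_distrib_right)
    also have "\<dots> = (\<Sum>(s,p)\<in>(SIGMA s:{s. s \<in> ?AB \<and> q - s \<in> ?C}. {p. p \<in> ?A \<and> s - p \<in> ?B}).
        hcoeff a p * hcoeff b (s - p) * hcoeff c (q - s))"
      by (rule sum.Sigma) (use finite_decomp[OF wo(2)[OF wo(1) wo(1)] wo(1)] finite_decomp[OF wo(1) wo(1)] in auto)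
    also have "\<dots> = (\<Sum>(p,s)\<in>(SIGMA p:{p. p \<in> ?A \<and> q - p \<in> ?BC}. {r. r \<in> ?B \<and> q - p - r \<in> ?C}).
        hcoeff a p * (hcoeff b s * hcoeff c (q - p - s)))"
      by (rule sum.reindex_bij_witness[of _ "\<lambda>(p,r). (p + r, p)" "\<lambda>(s,p). (p, s - p)"])
        (auto simp: set_sum_def algebra_simps, (metis add.commute add_diff_eq diff_add_cancel)+)
    also have "\<dots> = (\<Sum>p | p \<in> ?A \<and> q - p \<in> ?BC. \<Sum>r | r \<in> ?B \<and> q - p - r \<in> ?C.
        hcoeff a p * (hcoeff b r * hcoeff c (q - p - r)))"
      by (rule sum.Sigma[symmetric]) (use finite_decomp[OF wo(1) wo(2)[OF wo(1) wo(1)]] finite_decomp[OF wo(1) wo(1)] in auto)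
    also have "\<dots> = (\<Sum>p | p \<in> ?A \<and> q - p \<in> ?BC. hcoeff a p * hcoeff (b * c) (q - p))"
      by (subst hcoeff_times[where A = ?B and D = ?C]) (auto simp: wo sum_distrib_left)
    also have "\<dots> = hcoeff (a * (b * c)) q"
      by (rule hcoeff_times[symmetric]) (auto simp: wo times_hahn_def hsupp_hconv[THEN subsetD])
    finally show "hcoeff (a * b * c) q = hcoeff (a * (b * c)) q" .
  qed
  show "1 * a = a"
  proof (rule hahn_eqI)
    fix q
    have "hcoeff (1 * a) q = (\<Sum>p | p \<in> {0} \<and> q - p \<in> insert q (hsupp a). hcoeff 1 p * hcoeff a (q - p))"
    proof (rule hcoeff_times)
      have "well_ordered_set {q}" by (rule well_ordered_set_finite) simp
      then show "well_ordered_set (insert q (hsupp a))"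
        using well_ordered_set_Un[OF _ well_ordered_hsupp, of "{q}" a] by simp
    qed (auto simp: one_hahn_def intro: well_ordered_set_finite dest: hsupp_monom[THEN subsetD])
    also have "{p. p \<in> {0} \<and> q - p \<in> insert q (hsupp a)} = {0}" by auto
    finally show "hcoeff (1 * a) q = hcoeff a q" by (simp add: one_hahn_def hmonom.rep_eq)
  qed
  show "(a + b) * c = a * c + b * c"
  proof (rule hahn_eqI)
    fix q
    have "hcoeff (x * c) q = (\<Sum>p | p \<in> hsupp a \<union> hsupp b \<and> q - p \<in> hsupp c. hcoeff x p * hcoeff c (q - p))"
      if "hsupp x \<subseteq> hsupp a \<union> hsupp b" for x
      by (rule hcoeff_times) (use that in \<open>auto simp: wo\<close>)
    note this[of a] this[of b] this[of "a + b"]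
    then show "hcoeff ((a + b) * c) q = hcoeff (a * c + b * c) q"
      using hsupp_plus[of a b] by (simp add: plus_hahn.rep_eq distrib_right sum.distrib)
  qed
  have "hcoeff (0::'a hahn) 0 \<noteq> hcoeff (1::'a hahn) 0"
    by (simp add: one_hahn_def hmonom.rep_eq zero_hahn.rep_eq)
  then show "(0::'a hahn) \<noteq> 1" by metis
qed

end

subsection \<open>Inverses and order\<close>

text \<open>For \<open>f \<noteq> 0\<close> the minimum of the support exists, so \<open>Least\<close> is well defined there.\<close>

definition hval :: "'a::zero hahn \<Rightarrow> rat" where
  "hval f = (LEAST q. q \<in> hsupp f)"

lemma hval_props:
  assumes "f \<noteq> 0"
  shows "hval f \<in> hsupp f" "\<And>q. q \<in> hsupp f \<Longrightarrow> hval f \<le> q"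
proof -
  have "hsupp f \<noteq> {}" using assms by (auto simp: hsupp_def zero_hahn.rep_eq intro: hahn_eqI)
  then obtain m where m: "m \<in> hsupp f" "\<forall>q\<in>hsupp f. m \<le> q"
    using well_ordered_setD[OF well_ordered_hsupp, of "hsupp f"] by auto
  then have "hval f = m" unfolding hval_def by (intro Least_equality) auto
  then show "hval f \<in> hsupp f" "\<And>q. q \<in> hsupp f \<Longrightarrow> hval f \<le> q" using m by auto
qed

lemma hval_eqI:
  assumes "hcoeff f m \<noteq> 0" "\<And>q. q < m \<Longrightarrow> hcoeff f q = 0"
  shows "hval f = m" "f \<noteq> 0"
proof -
  show "hval f = m" unfolding hval_def
    by (intro Least_equality) (use assms in \<open>auto simp: hsupp_def not_less[symmetric]\<close>)
  show "f \<noteq> 0" using assms(1) by (auto simp: zero_hahn.rep_eq)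
qed

lemma hcoeff_below_hval: "f \<noteq> 0 \<Longrightarrow> q < hval f \<Longrightarrow> hcoeff f q = 0"
  using hval_props(2)[of f q] by (auto simp: hsupp_def)

definition hpos :: "'a::linordered_idom hahn \<Rightarrow> bool" where
  "hpos f \<longleftrightarrow> f \<noteq> 0 \<and> hcoeff f (hval f) > 0"

lemma hposI: "hcoeff f m > 0 \<Longrightarrow> (\<And>q. q < m \<Longrightarrow> hcoeff f q = 0) \<Longrightarrow> hpos f"
  using hval_eqI[of f m] by (auto simp: hpos_def)

lemma hpos_add: assumes "hpos f" "hpos g" shows "hpos (f + g)"
proof -
  have f: "f \<noteq> 0" "hcoeff f (hval f) > 0" and g: "g \<noteq> 0" "hcoeff g (hval g) > 0"
    using assms by (auto simp: hpos_def)
  let ?m = "min (hval f) (hval g)"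
  have "hcoeff (f + g) q = 0" if "q < ?m" for q
    using that f g by (auto simp: plus_hahn.rep_eq hcoeff_below_hval)
  moreover have "hcoeff (f + g) ?m > 0"
    using f g by (cases "hval f" "hval g" rule: linorder_cases)
      (auto simp: plus_hahn.rep_eq hcoeff_below_hval min_def)
  ultimately show ?thesis using hposI by blast
qed

lemma hcoeff_times_lowest:
  fixes f g :: "'a::comm_ring_1 hahn"
  assumes f: "f \<noteq> 0" and g: "g \<noteq> 0"
  shows "hcoeff (f * g) (hval f + hval g) = hcoeff f (hval f) * hcoeff g (hval g)"
    and "q < hval f + hval g \<Longrightarrow> hcoeff (f * g) q = 0"
proof -
  have *: "{p. hcoeff f p \<noteq> 0 \<and> hcoeff g (hval f + hval g - p) \<noteq> 0} = {hval f}"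
  proof (intro equalityI subsetI)
    fix p assume "p \<in> {p. hcoeff f p \<noteq> 0 \<and> hcoeff g (hval f + hval g - p) \<noteq> 0}"
    then have "hval f \<le> p" "hval g \<le> hval f + hval g - p"
      using hval_props(2)[OF f] hval_props(2)[OF g] by (auto simp: hsupp_def)
    then show "p \<in> {hval f}" by auto
  next
    fix p assume "p \<in> {hval f}"
    then show "p \<in> {p. hcoeff f p \<noteq> 0 \<and> hcoeff g (hval f + hval g - p) \<noteq> 0}"
      using hval_props(1)[OF f] hval_props(1)[OF g] by (auto simp: hsupp_def)
  qed
  show "hcoeff (f * g) (hval f + hval g) = hcoeff f (hval f) * hcoeff g (hval g)"
    unfolding times_hahn_def hconv.rep_eq * by simp
  assume q: "q < hval f + hval g"
  have "{p. hcoeff f p \<noteq> 0 \<and> hcoeff g (q - p) \<noteq> 0} = {}"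
  proof (intro equals0I)
    fix p assume "p \<in> {p. hcoeff f p \<noteq> 0 \<and> hcoeff g (q - p) \<noteq> 0}"
    then have "hval f \<le> p" "hval g \<le> q - p"
      using hval_props(2)[OF f] hval_props(2)[OF g] by (auto simp: hsupp_def)
    then show False using q by linarith
  qed
  then show "hcoeff (f * g) q = 0" unfolding times_hahn_def hconv.rep_eq by (simp only: sum.empty)
qed

instance hahn :: (idom) idom
proof
  fix f g :: "'a hahn"
  assume fg: "f \<noteq> 0" "g \<noteq> 0"
  then have "hcoeff (f * g) (hval f + hval g) \<noteq> 0"
    using hcoeff_times_lowest(1)[OF fg] hval_props(1)[of f] hval_props(1)[of g]
    by (simp add: hsupp_def)
  then show "f * g \<noteq> 0" by (metis zero_hahn.rep_eq)
qed

lemma hcoeff_times_vanish: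
  fixes f g :: "'a::comm_ring_1 hahn"
  assumes "\<And>q. q < s \<Longrightarrow> hcoeff f q = 0" "\<And>q. q < t \<Longrightarrow> hcoeff g q = 0" "q < s + t"
  shows "hcoeff (f * g) q = 0"
proof -
  have "{p. hcoeff f p \<noteq> 0 \<and> hcoeff g (q - p) \<noteq> 0} = {}"
  proof (intro equals0I)
    fix p assume "p \<in> {p. hcoeff f p \<noteq> 0 \<and> hcoeff g (q - p) \<noteq> 0}"
    then have "s \<le> p" "t \<le> q - p" using assms(1,2) by (auto simp: not_less[symmetric])
    then show False using assms(3) by linarith
  qed
  then show ?thesis unfolding times_hahn_def hconv.rep_eq by (simp only: sum.empty)
qed

lemma hcoeff_sum: "hcoeff (sum F S) q = (\<Sum>x\<in>S. hcoeff (F x) q)"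
  by (induction S rule: infinite_finite_induct) (auto simp: zero_hahn.rep_eq plus_hahn.rep_eq)

lemma hahn_inverse_one_minus:
  fixes e :: "'a::comm_ring_1 hahn"
  assumes m: "m > 0" "\<And>q. q < m \<Longrightarrow> hcoeff e q = 0"
  shows "\<exists>g. (1 - e) * g = 1"
proof -
  have pow: "hcoeff (e ^ n) q = 0" if "q < of_nat n * m" for n q
    using that
  proof (induction n arbitrary: q)
    case 0
    then show ?case by (simp add: one_hahn_def hmonom.rep_eq)
  next
    case (Suc n)
    show ?case unfolding power_Suc
    proof (rule hcoeff_times_vanish)
      show "q < m + of_nat n * m" using Suc.prems by (simp add: distrib_right)
    qed (fact m(2), fact Suc.IH)
  qed
  define G where "G = (\<lambda>K. \<Sum>n<K. e ^ n)"
  define N where "N = (\<lambda>q. Suc (nat \<lceil>q / m\<rceil>))"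
  have N: "x < of_nat K * m" if "x \<le> q" "N q \<le> K" for x q K
  proof -
    have "x / m \<le> q / m" using that m by (simp add: divide_right_mono)
    also have "\<dots> \<le> of_nat (nat \<lceil>q / m\<rceil>)" by (rule of_nat_ceiling)
    also have "\<dots> < of_nat (N q)" by (simp add: N_def)
    also have "\<dots> \<le> of_nat K" using that by simp
    finally show ?thesis using m by (simp add: pos_divide_less_eq)
  qed
  have stable: "hcoeff (G K) x = hcoeff (G (N q)) x" if "x \<le> q" "N q \<le> K" for x q K
    unfolding G_def hcoeff_sum
  proof (rule sum.mono_neutral_right)
    show "\<forall>i\<in>{..<K} - {..<N q}. hcoeff (e ^ i) x = 0"
    proof
      fix i assume "i \<in> {..<K} - {..<N q}"
      then have "N q \<le> i" by simp
      from pow[OF N[OF that(1) this]] show "hcoeff (e ^ i) x = 0" .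
    qed
  qed (use that(2) in auto)
  have N_mono: "N x \<le> N q" if "x \<le> q" for x q
  proof -
    have "x / m \<le> q / m" using that m(1) by (simp add: divide_right_mono)
    then show ?thesis unfolding N_def by (intro Suc_le_mono[THEN iffD2] nat_mono ceiling_mono)
  qed
  have "well_ordered_set {q. hcoeff (G (N q)) q \<noteq> 0}"
    unfolding well_ordered_set_def
  proof (intro allI impI, elim conjE)
    fix T assume T: "T \<subseteq> {q. hcoeff (G (N q)) q \<noteq> 0}" "T \<noteq> {}"
    then obtain t where t: "t \<in> T" by auto
    have "{x\<in>T. x \<le> t} \<subseteq> hsupp (G (N t))"
    proof
      fix x assume x: "x \<in> {x\<in>T. x \<le> t}"
      then have "hcoeff (G (N t)) x = hcoeff (G (N x)) x" by (intro stable N_mono) auto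
      then show "x \<in> hsupp (G (N t))" using x T(1) by (auto simp: hsupp_def)
    qed
    moreover have "{x\<in>T. x \<le> t} \<noteq> {}" using t by auto
    ultimately have "\<exists>x\<in>{x\<in>T. x \<le> t}. \<forall>y\<in>{x\<in>T. x \<le> t}. x \<le> y"
      by (rule well_ordered_setD[OF well_ordered_hsupp])
    then obtain x where x: "x \<in> T" "x \<le> t" "\<And>y. y \<in> T \<Longrightarrow> y \<le> t \<Longrightarrow> x \<le> y" by auto
    have "x \<le> y" if "y \<in> T" for y
      using x(2) x(3)[OF that] by linarith
    then show "\<exists>x\<in>T. \<forall>y\<in>T. x \<le> y" using x by blast
  qed
  then obtain g where g: "\<And>q. hcoeff g q = hcoeff (G (N q)) q"
    using that[of "Abs_hahn (\<lambda>q. hcoeff (G (N q)) q)"] by (simp add: Abs_hahn_inverse)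
  have "(1 - e) * g = 1"
  proof (rule hahn_eqI)
    fix q
    let ?K = "N (q + 1)"
    have "hcoeff ((1 - e) * (g - G ?K)) q = 0"
    proof (rule hcoeff_times_vanish[where s = 0 and t = "q + 1"])
      show "hcoeff (1 - e) x = 0" if "x < 0" for x
        using that m(1) m(2)[of x] by (simp add: minus_hahn.rep_eq one_hahn_def hmonom.rep_eq)
      show "hcoeff (g - G ?K) x = 0" if "x < q + 1" for x
      proof -
        have "hcoeff (G ?K) x = hcoeff (G (N x)) x"
          using that by (intro stable N_mono) auto
        then show ?thesis by (simp only: minus_hahn.rep_eq g diff_self)
      qed
    qed simp
    moreover have "(1 - e) * G ?K = 1 - e ^ ?K"
      unfolding G_def by (rule one_diff_power_eq[symmetric])
    moreover have "hcoeff (e ^ ?K) q = 0" using N[of q "q + 1" ?K] by (intro pow) simp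
    moreover have "(1 - e) * g = (1 - e) * (g - G ?K) + (1 - e) * G ?K"
      by (simp add: algebra_simps)
    ultimately show "hcoeff ((1 - e) * g) q = hcoeff 1 q"
      by (simp add: plus_hahn.rep_eq minus_hahn.rep_eq)
  qed
  then show ?thesis by blast
qed

lemma hahn_inverse_ex:
  fixes f :: "'a::field hahn"
  assumes f: "f \<noteq> 0"
  shows "\<exists>g. f * g = 1"
proof -
  let ?c = "hcoeff f (hval f)"
  define u where "u = hmonom (- hval f) (1 / ?c)"
  have c: "?c \<noteq> 0" using hval_props(1)[OF f] by (simp add: hsupp_def)
  have u: "hval u = - hval f" "u \<noteq> 0"
    using c hval_eqI[of u "- hval f"] by (auto simp: u_def hmonom.rep_eq)
  have "hcoeff (u * f) 0 = 1" "\<And>q. q < 0 \<Longrightarrow> hcoeff (u * f) q = 0"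
    using hcoeff_times_lowest[OF u(2) f] u(1) c by (auto simp: u_def hmonom.rep_eq)
  then have e: "hcoeff (1 - u * f) q = 0" if "q \<le> 0" for q
    using that by (cases "q = 0") (auto simp: minus_hahn.rep_eq one_hahn_def hmonom.rep_eq)
  obtain m where m: "m > 0" "\<And>q. q < m \<Longrightarrow> hcoeff (1 - u * f) q = 0"
  proof (cases "1 - u * f = 0")
    case True
    then show ?thesis using that[of 1] by (simp add: zero_hahn.rep_eq)
  next
    case False
    then have "hval (1 - u * f) > 0"
      using hval_props(1)[OF False] e by (auto simp: hsupp_def not_le[symmetric])
    then show ?thesis using that hcoeff_below_hval[OF False] by blast
  qed
  then obtain g where "(1 - (1 - u * f)) * g = 1" using hahn_inverse_one_minus by blast
  then have "f * (u * g) = 1" by (simp add: ac_simps)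
  then show ?thesis by blast
qed

instantiation hahn :: (field) field
begin

definition inverse_hahn :: "'a hahn \<Rightarrow> 'a hahn" where
  "inverse_hahn f = (if f = 0 then 0 else (SOME g. f * g = 1))"

definition divide_hahn :: "'a hahn \<Rightarrow> 'a hahn \<Rightarrow> 'a hahn" where
  "divide_hahn f g = f * inverse g"

instance
proof
  fix f g :: "'a hahn"
  show "inverse f * f = 1" if "f \<noteq> 0"
  proof -
    have "f * inverse f = 1"
      using someI_ex[OF hahn_inverse_ex[OF that]] that by (simp only: inverse_hahn_def if_False)
    then show ?thesis by (simp only: mult.commute)
  qed
  show "f div g = f * inverse g" by (simp add: divide_hahn_def)
  show "inverse (0 :: 'a hahn) = 0" by (simp add: inverse_hahn_def)
qed

end

lemma hpos_mult: assumes "hpos f" "hpos g" shows "hpos (f * g)"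
  using assms hcoeff_times_lowest[of f g]
  by (intro hposI[of _ "hval f + hval g"]) (auto simp: hpos_def)

lemma hpos_cases: "f = 0 \<or> hpos f \<or> hpos (- f)"
proof (cases "f = 0")
  case False
  then have "hcoeff f (hval f) \<noteq> 0" using hval_props(1)[of f] by (simp add: hsupp_def)
  then consider "hcoeff f (hval f) > 0" | "hcoeff f (hval f) < 0" by linarith
  then show ?thesis
  proof cases
    case 2
    then have "hpos (- f)"
      by (intro hposI[of _ "hval f"]) (auto simp: uminus_hahn.rep_eq hcoeff_below_hval False)
    then show ?thesis by simp
  qed (use False in \<open>auto simp: hpos_def\<close>)
qed auto

lemma hpos_asym: "hpos f \<Longrightarrow> \<not> hpos (- f)"
  using hpos_add[of f "- f"] by (auto simp: hpos_def)

instantiation hahn :: (linordered_idom) linordered_idom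
begin

definition less_hahn :: "'a hahn \<Rightarrow> 'a hahn \<Rightarrow> bool" where
  "less_hahn f g \<longleftrightarrow> hpos (g - f)"

definition less_eq_hahn :: "'a hahn \<Rightarrow> 'a hahn \<Rightarrow> bool" where
  "less_eq_hahn f g \<longleftrightarrow> f = g \<or> hpos (g - f)"

definition abs_hahn :: "'a hahn \<Rightarrow> 'a hahn" where
  "abs_hahn f = (if f < 0 then - f else f)"

definition sgn_hahn :: "'a hahn \<Rightarrow> 'a hahn" where
  "sgn_hahn f = (if f = 0 then 0 else if 0 < f then 1 else - 1)"

instance
proof
  fix f g h :: "'a hahn"
  show "f \<le> f" by (simp add: less_eq_hahn_def)
  show lt: "f < g \<longleftrightarrow> f \<le> g \<and> \<not> g \<le> f"
    using hpos_asym[of "g - f"] by (auto simp: less_eq_hahn_def less_hahn_def hpos_def)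
  show "f \<le> g \<Longrightarrow> g \<le> h \<Longrightarrow> f \<le> h"
    using hpos_add[of "g - f" "h - g"] by (auto simp: less_eq_hahn_def)
  show "f \<le> g \<Longrightarrow> g \<le> f \<Longrightarrow> f = g"
    using hpos_asym[of "g - f"] by (auto simp: less_eq_hahn_def)
  show "f \<le> g \<or> g \<le> f"
    using hpos_cases[of "g - f"] by (auto simp: less_eq_hahn_def)
  show "f \<le> g \<Longrightarrow> h + f \<le> h + g" by (auto simp: less_eq_hahn_def)
  show "f < g \<Longrightarrow> 0 < h \<Longrightarrow> h * f < h * g"
    using hpos_mult[of h "g - f"] by (auto simp: less_hahn_def right_diff_distrib)
  show "\<bar>f\<bar> = (if f < 0 then - f else f)" by (simp add: abs_hahn_def)
  show "sgn f = (if f = 0 then 0 else if 0 < f then 1 else - 1)" by (simp add: sgn_hahn_def)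
qed

end

instance hahn :: (linordered_field) linordered_field ..

text \<open>The inclusion of real into complex series, and the resulting partial order on complex
  series: \<open>a \<preceq> b\<close> means that both are real series and \<open>a \<le> b\<close>.\<close>

definition hreal :: "real hahn \<Rightarrow> complex hahn" where
  "hreal = hmap complex_of_real"

definition hle :: "complex hahn \<Rightarrow> complex hahn \<Rightarrow> bool" (infix \<open>\<preceq>\<close> 50) where
  "a \<preceq> b \<longleftrightarrow> (\<exists>x y :: real hahn. a = hreal x \<and> b = hreal y \<and> x \<le> y)"

definition hbar :: "complex hahn" where
  "hbar = hmonom 1 1"

definition hi :: "complex hahn" where
  "hi = hmonom 0 \<i>"

section \<open>Smooth functions and symplectic manifolds\<close>

primrec ck_on :: "nat \<Rightarrow> 'a::real_normed_vector set \<Rightarrow> ('a \<Rightarrow> 'b::real_normed_vector) \<Rightarrow> bool" where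
  "ck_on 0 S f \<longleftrightarrow> continuous_on S f"
| "ck_on (Suc k) S f \<longleftrightarrow> (\<forall>x\<in>S. f differentiable (at x)) \<and>
     (\<forall>v. ck_on k S (\<lambda>x. frechet_derivative f (at x) v))"

text \<open>Only used for open \<open>S\<close> in a finite-dimensional space.\<close>

definition smooth_on :: "'a::real_normed_vector set \<Rightarrow> ('a \<Rightarrow> 'b::real_normed_vector) \<Rightarrow> bool" where
  "smooth_on S f \<longleftrightarrow> (\<forall>k. ck_on k S f)"

text \<open>The model space is any finite-dimensional real normed space, rather than a type of class
  \<open>euclidean_space\<close>, because the latter would exclude manifolds of dimension \<open>0\<close>.
  An atlas need not be maximal.\<close>

type_synonym ('m, 'e) chart = "'m set \<times> ('m \<Rightarrow> 'e)"

locale smooth_manifold =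
  fixes M :: "'m topology" and \<A> :: "('m, 'e::real_normed_vector) chart set"
  assumes finite_dim: "\<exists>B::'e set. finite B \<and> span B = UNIV"
    and hausdorff: "Hausdorff_space M"
    and second_countable: "second_countable M"
    and cover: "topspace M = (\<Union>(U, \<phi>)\<in>\<A>. U)"
    and chart_domain: "(U, \<phi>) \<in> \<A> \<Longrightarrow> openin M U"
    and chart_image: "(U, \<phi>) \<in> \<A> \<Longrightarrow> open (\<phi> ` U)"
    and chart_homeomorphic: "(U, \<phi>) \<in> \<A> \<Longrightarrow>
      homeomorphic_map (subtopology M U) (top_of_set (\<phi> ` U)) \<phi>"
    and chart_transition: "(U, \<phi>) \<in> \<A> \<Longrightarrow> (V, \<psi>) \<in> \<A> \<Longrightarrow>
      smooth_on (\<phi> ` (U \<inter> V)) (\<psi> \<circ> inv_into U \<phi>)"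

text \<open>A 2-form is given by its local representatives: \<open>\<omega> c p u v\<close> is the value of the form at
  \<open>p\<close> on the tangent vectors with components \<open>u\<close>, \<open>v\<close> in the chart \<open>c\<close>.\<close>

locale symplectic_manifold = smooth_manifold M \<A>
  for M :: "'m topology" and \<A> :: "('m, 'e::real_normed_vector) chart set" +
  fixes \<omega> :: "('m, 'e) chart \<Rightarrow> 'm \<Rightarrow> 'e \<Rightarrow> 'e \<Rightarrow> real"
  assumes form_linear: "(U, \<phi>) \<in> \<A> \<Longrightarrow> p \<in> U \<Longrightarrow> linear (\<omega> (U, \<phi>) p u)"
    and form_alternating: "(U, \<phi>) \<in> \<A> \<Longrightarrow> p \<in> U \<Longrightarrow> \<omega> (U, \<phi>) p u v = - \<omega> (U, \<phi>) p v u"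
    and form_transition: "(U, \<phi>) \<in> \<A> \<Longrightarrow> (V, \<psi>) \<in> \<A> \<Longrightarrow> p \<in> U \<inter> V \<Longrightarrow>
      \<omega> (U, \<phi>) p u v =
      \<omega> (V, \<psi>) p (frechet_derivative (\<psi> \<circ> inv_into U \<phi>) (at (\<phi> p)) u)
                 (frechet_derivative (\<psi> \<circ> inv_into U \<phi>) (at (\<phi> p)) v)"
    and form_smooth: "(U, \<phi>) \<in> \<A> \<Longrightarrow> smooth_on (\<phi> ` U) (\<lambda>x. \<omega> (U, \<phi>) (inv_into U \<phi> x) u v)"
    and form_nondegenerate: "(U, \<phi>) \<in> \<A> \<Longrightarrow> p \<in> U \<Longrightarrow> u \<noteq> 0 \<Longrightarrow> \<exists>v. \<omega> (U, \<phi>) p u v \<noteq> 0"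
    and form_closed: "(U, \<phi>) \<in> \<A> \<Longrightarrow> p \<in> U \<Longrightarrow>
      frechet_derivative (\<lambda>x. \<omega> (U, \<phi>) (inv_into U \<phi> x) v w) (at (\<phi> p)) u +
      frechet_derivative (\<lambda>x. \<omega> (U, \<phi>) (inv_into U \<phi> x) w u) (at (\<phi> p)) v +
      frechet_derivative (\<lambda>x. \<omega> (U, \<phi>) (inv_into U \<phi> x) u v) (at (\<phi> p)) w = 0"

text \<open>\<open>C\<^sup>\<infinity>(M)\<close>: functions on the carrier of \<open>M\<close> are represented by total functions that vanish
  off the carrier. In particular the constant function \<open>1\<close> is the indicator of the carrier.\<close>

definition smooth_funs ::
  "'m topology \<Rightarrow> ('m, 'e::real_normed_vector) chart set \<Rightarrow> ('m \<Rightarrow> complex) set" where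
  "smooth_funs M \<A> = {f. (\<forall>p. p \<notin> topspace M \<longrightarrow> f p = 0) \<and>
     (\<forall>(U, \<phi>)\<in>\<A>. smooth_on (\<phi> ` U) (f \<circ> inv_into U \<phi>))}"

definition one_fun :: "'m topology \<Rightarrow> 'm \<Rightarrow> complex" where
  "one_fun M = indicator (topspace M)"

subsection \<open>Poisson bracket\<close>

definition chart_differential :: "('m, 'e::real_normed_vector) chart \<Rightarrow> ('m \<Rightarrow> real) \<Rightarrow> 'm \<Rightarrow> 'e \<Rightarrow> real" where
  "chart_differential c f p = frechet_derivative (f \<circ> inv_into (fst c) (snd c)) (at (snd c p))"

definition hamiltonian_vector ::
  "(('m, 'e::real_normed_vector) chart \<Rightarrow> 'm \<Rightarrow> 'e \<Rightarrow> 'e \<Rightarrow> real) \<Rightarrow> ('m, 'e) chart \<Rightarrow>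
   ('m \<Rightarrow> real) \<Rightarrow> 'm \<Rightarrow> 'e" where
  "hamiltonian_vector \<omega> c f p = (THE u. \<forall>v. \<omega> c p u v = chart_differential c f p v)"

text \<open>\<open>{f, g} = \<omega>(X\<^sub>f, X\<^sub>g)\<close> with \<open>\<omega>(X\<^sub>f, \<cdot>) = df\<close>, so that \<open>{q, p} = 1\<close> for \<open>\<omega> = dq \<and> dp\<close>.
  The value does not depend on the chart around the point.\<close>

definition poisson_real ::
  "('m, 'e::real_normed_vector) chart set \<Rightarrow> (('m, 'e) chart \<Rightarrow> 'm \<Rightarrow> 'e \<Rightarrow> 'e \<Rightarrow> real) \<Rightarrow>
   ('m \<Rightarrow> real) \<Rightarrow> ('m \<Rightarrow> real) \<Rightarrow> 'm \<Rightarrow> real" where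
  "poisson_real \<A> \<omega> f g p =
     (let c = (SOME c. c \<in> \<A> \<and> p \<in> fst c)
      in \<omega> c p (hamiltonian_vector \<omega> c f p) (hamiltonian_vector \<omega> c g p))"

text \<open>Complex-bilinear extension.\<close>

definition poisson ::
  "'m topology \<Rightarrow> ('m, 'e::real_normed_vector) chart set \<Rightarrow>
   (('m, 'e) chart \<Rightarrow> 'm \<Rightarrow> 'e \<Rightarrow> 'e \<Rightarrow> real) \<Rightarrow>
   ('m \<Rightarrow> complex) \<Rightarrow> ('m \<Rightarrow> complex) \<Rightarrow> 'm \<Rightarrow> complex" where
  "poisson M \<A> \<omega> f g p =
     (if p \<in> topspace M
      then Complex
        (poisson_real \<A> \<omega> (Re \<circ> f) (Re \<circ> g) p - poisson_real \<A> \<omega> (Im \<circ> f) (Im \<circ> g) p)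
        (poisson_real \<A> \<omega> (Re \<circ> f) (Im \<circ> g) p + poisson_real \<A> \<omega> (Im \<circ> f) (Re \<circ> g) p)
      else 0)"

subsection \<open>Bidifferential operators\<close>

primrec iterated_derivative ::
  "'e::real_normed_vector list \<Rightarrow> ('e \<Rightarrow> 'b::real_normed_vector) \<Rightarrow> 'e \<Rightarrow> 'b" where
  "iterated_derivative [] f = f"
| "iterated_derivative (v # vs) f = (\<lambda>x. frechet_derivative (iterated_derivative vs f) (at x) v)"

text \<open>In each chart, a finite combination, with smooth coefficients, of products
  \<open>\<partial>\<^bsub>u\<^sub>1\<^esub>\<dots>\<partial>\<^bsub>u\<^sub>i\<^esub>f \<cdot> \<partial>\<^bsub>v\<^sub>1\<^esub>\<dots>\<partial>\<^bsub>v\<^sub>j\<^esub>g\<close> along constant vectors, equivalently of products of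
  coordinate partial derivatives, of order bounded uniformly over the charts.\<close>

definition bidifferential_operator ::
  "'m topology \<Rightarrow> ('m, 'e::real_normed_vector) chart set \<Rightarrow>
   (('m \<Rightarrow> complex) \<Rightarrow> ('m \<Rightarrow> complex) \<Rightarrow> 'm \<Rightarrow> complex) \<Rightarrow> bool" where
  "bidifferential_operator M \<A> C \<longleftrightarrow>
     (\<forall>f\<in>smooth_funs M \<A>. \<forall>g\<in>smooth_funs M \<A>. C f g \<in> smooth_funs M \<A>) \<and>
     (\<exists>N. \<forall>(U, \<phi>)\<in>\<A>. \<exists>(I :: ('e list \<times> 'e list) set) (a :: 'e list \<Rightarrow> 'e list \<Rightarrow> 'e \<Rightarrow> complex).
        finite I \<and>
        (\<forall>(us, vs)\<in>I. length us \<le> N \<and> length vs \<le> N \<and> smooth_on (\<phi> ` U) (a us vs)) \<and>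
        (\<forall>f\<in>smooth_funs M \<A>. \<forall>g\<in>smooth_funs M \<A>. \<forall>p\<in>U.
           C f g p = (\<Sum>(us, vs)\<in>I. a us vs (\<phi> p) *
             iterated_derivative us (f \<circ> inv_into U \<phi>) (\<phi> p) *
             iterated_derivative vs (g \<circ> inv_into U \<phi>) (\<phi> p))))"

section \<open>Star products and states\<close>

definition smooth_series ::
  "'m topology \<Rightarrow> ('m, 'e::real_normed_vector) chart set \<Rightarrow> ('m \<Rightarrow> complex) hahn set" where
  "smooth_series M \<A> = {f. \<forall>q. hcoeff f q \<in> smooth_funs M \<A>}"

definition hscale :: "complex hahn \<Rightarrow> ('m \<Rightarrow> complex) hahn \<Rightarrow> ('m \<Rightarrow> complex) hahn" (infixr \<open>\<bullet>\<^sub>h\<close> 75) where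
  "a \<bullet>\<^sub>h f = hconv (\<lambda>c f x. c * f x) a f"

definition one_series :: "'m topology \<Rightarrow> ('m \<Rightarrow> complex) hahn" where
  "one_series M = hmonom 0 (one_fun M)"

definition hconj :: "('m \<Rightarrow> complex) hahn \<Rightarrow> ('m \<Rightarrow> complex) hahn" where
  "hconj = hmap (\<lambda>f x. cnj (f x))"

text \<open>The last conjunct says \<open>f * g = \<Sum>\<^sub>k C\<^sub>k(f, g) \<hbar>\<^sup>k\<close>, coefficient by coefficient. The sum over
  \<open>k\<close> has only finitely many non-zero terms, see \<open>finite_star_terms\<close> below.\<close>

definition star_product ::
  "'m topology \<Rightarrow> ('m, 'e::real_normed_vector) chart set \<Rightarrow>
   (('m, 'e) chart \<Rightarrow> 'm \<Rightarrow> 'e \<Rightarrow> 'e \<Rightarrow> real) \<Rightarrow>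
   (('m \<Rightarrow> complex) hahn \<Rightarrow> ('m \<Rightarrow> complex) hahn \<Rightarrow> ('m \<Rightarrow> complex) hahn) \<Rightarrow> bool" where
  "star_product M \<A> \<omega> star \<longleftrightarrow>
     (\<forall>f\<in>smooth_series M \<A>. \<forall>g\<in>smooth_series M \<A>. star f g \<in> smooth_series M \<A>) \<and>
     (\<forall>f\<in>smooth_series M \<A>. \<forall>g\<in>smooth_series M \<A>. \<forall>h\<in>smooth_series M \<A>.
        star (star f g) h = star f (star g h)) \<and>
     (\<forall>f\<in>smooth_series M \<A>. \<forall>g\<in>smooth_series M \<A>. \<forall>h\<in>smooth_series M \<A>. \<forall>a.
        star (a \<bullet>\<^sub>h f + g) h = a \<bullet>\<^sub>h star f h + star g h \<and>
        star h (a \<bullet>\<^sub>h f + g) = a \<bullet>\<^sub>h star h f + star h g) \<and>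
     (\<exists>C :: nat \<Rightarrow> ('m \<Rightarrow> complex) \<Rightarrow> ('m \<Rightarrow> complex) \<Rightarrow> 'm \<Rightarrow> complex.
        (\<forall>k. bidifferential_operator M \<A> (C k)) \<and>
        (\<forall>f\<in>smooth_funs M \<A>. \<forall>g\<in>smooth_funs M \<A>. C 0 f g = (\<lambda>p. f p * g p)) \<and>
        (\<forall>k\<ge>1. \<forall>f\<in>smooth_funs M \<A>. C k (one_fun M) f = 0 \<and> C k f (one_fun M) = 0) \<and>
        (\<forall>f\<in>smooth_funs M \<A>. \<forall>g\<in>smooth_funs M \<A>.
           C 1 f g - C 1 g f = (\<lambda>p. \<i> * poisson M \<A> \<omega> f g p)) \<and>
        (\<forall>f\<in>smooth_series M \<A>. \<forall>g\<in>smooth_series M \<A>. \<forall>q.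
           hcoeff (star f g) q =
             (\<Sum>k | hcoeff (hconv (C k) f g) (q - of_nat k) \<noteq> 0.
                hcoeff (hconv (C k) f g) (q - of_nat k))))"

lemma finite_star_terms:
  fixes f g :: "'a::comm_monoid_add hahn" and C :: "nat \<Rightarrow> 'a \<Rightarrow> 'a \<Rightarrow> 'a"
  shows "finite {k. hcoeff (hconv (C k) f g) (q - of_nat k) \<noteq> 0}"
proof (cases "set_sum (hsupp f) (hsupp g) = {}")
  case True
  then have "{k. hcoeff (hconv (C k) f g) (q - of_nat k) \<noteq> 0} = {}"
    using hsupp_hconv[of _ f g] by (auto simp: hsupp_def)
  then show ?thesis by simp
next
  case False
  then obtain m where m: "\<forall>x\<in>set_sum (hsupp f) (hsupp g). m \<le> x"
    using well_ordered_setD[OF well_ordered_set_sum[OF well_ordered_hsupp well_ordered_hsupp]] by blast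
  have "{k. hcoeff (hconv (C k) f g) (q - of_nat k) \<noteq> 0} \<subseteq> {..nat \<lceil>q - m\<rceil>}"
  proof
    fix k assume "k \<in> {k. hcoeff (hconv (C k) f g) (q - of_nat k) \<noteq> 0}"
    then have "q - of_nat k \<in> set_sum (hsupp f) (hsupp g)"
      using hsupp_hconv[of "C k" f g] by (auto simp: hsupp_def)
    then have "rat_of_nat k \<le> q - m" using m by fastforce
    then show "k \<in> {..nat \<lceil>q - m\<rceil>}" by simp linarith
  qed
  then show ?thesis using finite_subset by blast
qed

definition star_bracket ::
  "(('m \<Rightarrow> complex) hahn \<Rightarrow> ('m \<Rightarrow> complex) hahn \<Rightarrow> ('m \<Rightarrow> complex) hahn) \<Rightarrow>
   ('m \<Rightarrow> complex) hahn \<Rightarrow> ('m \<Rightarrow> complex) hahn \<Rightarrow> ('m \<Rightarrow> complex) hahn" where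
  "star_bracket star f g = (1 / (hi * hbar)) \<bullet>\<^sub>h (star f g - star g f)"

definition star_state ::
  "'m topology \<Rightarrow> ('m, 'e::real_normed_vector) chart set \<Rightarrow>
   (('m \<Rightarrow> complex) hahn \<Rightarrow> ('m \<Rightarrow> complex) hahn \<Rightarrow> ('m \<Rightarrow> complex) hahn) \<Rightarrow>
   (('m \<Rightarrow> complex) hahn \<Rightarrow> complex hahn) \<Rightarrow> bool" where
  "star_state M \<A> star \<rho> \<longleftrightarrow>
     (\<forall>f\<in>smooth_series M \<A>. \<forall>g\<in>smooth_series M \<A>. \<forall>a. \<rho> (a \<bullet>\<^sub>h f + g) = a * \<rho> f + \<rho> g) \<and>
     (\<forall>f\<in>smooth_series M \<A>. 0 \<preceq> \<rho> (star (hconj f) f)) \<and>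
     \<rho> (one_series M) = 1"

end

theory Submission
  imports Defs
begin

text \<open>
  Let \<open>G\<^sub>j\<^sub>k = \<rho>(\<delta>X\<^sub>j * \<delta>X\<^sub>k)\<close>. Positivity of the state makes \<open>G\<close> a positive semidefinite Hermitian
  matrix: \<open>\<rho>(f\<^sup>* * f) \<ge> 0\<close> for the combinations \<open>f = \<Sum>\<^sub>j (y\<^sub>j + i x\<^sub>j) \<delta>X\<^sub>j\<close> with real series \<open>x\<^sub>j\<close>, \<open>y\<^sub>j\<close>,
  where \<open>f\<^sup>*\<close> is the conjugate of \<open>f\<close>. Write \<open>G = A + i B\<close> with \<open>A\<close>, \<open>B\<close> real. Then \<open>A\<close> is the matrix
  of symmetrized correlations. Since scalars commute with everything, commutators do not see the
  shift by \<open>\<rho>(X\<^sub>j)\<close>, and \<open>B\<close> is the matrix of the \<open>(\<hbar>/2) \<rho>({X\<^sub>j, X\<^sub>k}\<^sub>*)\<close>. In terms of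
  \<open>A\<close> and \<open>B\<close> positivity reads \<open>2 y\<^sup>T B x \<le> x\<^sup>T A x + y\<^sup>T A y\<close> (\<open>corr_det_le\<close>).

  It remains to deduce \<open>det B \<le> det A\<close> over the ordered field of real series
  (\<open>det_le_of_form_bound\<close>). Simultaneous normal forms over the real numbers would give this, but
  there is an argument for every ordered field. For invertible \<open>A\<close> the choice
  \<open>y = A\<inverse> B x\<close> turns the bound into \<open>0 \<le> B\<^sup>T A\<inverse> B \<le> A\<close>, and the determinant is monotone on
  positive semidefinite forms (\<open>det_mono\<close>, by induction with Schur complements), so
  \<open>(det B)\<^sup>2 \<le> (det A)\<^sup>2\<close>.

  To apply positivity one needs that smooth series are closed under linear combinations
  (\<open>hscale_series\<close>), that the constant series \<open>1\<close> is a unit for the star product (\<open>star_one\<close>), and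
  that expectations of self-adjoint elements are real (\<open>state_real\<close>, by polarization).
\<close>

section \<open>Determinants of positive semidefinite matrices over an ordered field\<close>

definition qform :: "nat \<Rightarrow> (nat \<Rightarrow> nat \<Rightarrow> 'a::comm_ring_1) \<Rightarrow> (nat \<Rightarrow> 'a) \<Rightarrow> 'a" where
  "qform n a x = (\<Sum>i<n. \<Sum>j<n. x i * a i j * x j)"

definition schur :: "nat \<Rightarrow> (nat \<Rightarrow> nat \<Rightarrow> 'a::field) \<Rightarrow> nat \<Rightarrow> nat \<Rightarrow> 'a" where
  "schur n a i j = a i j - a i n * a n j / a n n"

lemma qform_cong: "(\<And>i. i < n \<Longrightarrow> x i = y i) \<Longrightarrow> qform n a x = qform n a y"
  unfolding qform_def by (intro sum.cong) auto

lemma qform_Suc: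
  assumes "\<forall>i<n. a i n = a n i"
  shows "qform (Suc n) a x = qform n a x + 2 * x n * (\<Sum>j<n. a n j * x j) + a n n * (x n)\<^sup>2"
proof -
  have "(\<Sum>i<n. x i * a i n * x n) = x n * (\<Sum>j<n. a n j * x j)"
    by (auto simp: sum_distrib_left assms ac_simps intro!: sum.cong)
  moreover have "(\<Sum>j<n. x n * a n j * x j) = x n * (\<Sum>j<n. a n j * x j)"
    by (auto simp: sum_distrib_left ac_simps intro!: sum.cong)
  ultimately show ?thesis
    by (simp add: qform_def sum.distrib algebra_simps power2_eq_square)
qed

lemma qform_schur:
  assumes "\<forall>i<n. a i n = a n i"
  shows "qform n (schur n a) x = qform n a x - (\<Sum>j<n. a n j * x j)\<^sup>2 / a n n"
proof -
  have "(\<Sum>j<n. a n j * x j)\<^sup>2 / a n n = (\<Sum>i<n. \<Sum>j<n. (a n i * x i) * (a n j * x j) / a n n)"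
    by (simp add: power2_eq_square sum_product sum_divide_distrib)
  then show ?thesis
    by (auto simp: qform_def schur_def sum_subtractf[symmetric] assms algebra_simps
        intro!: sum.cong)
qed

lemma qform_complete_square:
  assumes "\<forall>i<n. a i n = a n i" and "a n n \<noteq> 0"
  shows "qform (Suc n) a x =
    qform n (schur n a) x + a n n * (x n + (\<Sum>j<n. a n j * x j) / a n n)\<^sup>2"
  unfolding qform_Suc[OF assms(1)] qform_schur[OF assms(1)]
  using assms(2) by (simp add: field_simps power2_eq_square)

text \<open>Block elimination: the matrix factors as \<open>[S, b; 0, c] [1, 0; r, 1]\<close> with \<open>S\<close> the Schur complement of
  the last diagonal entry \<open>c\<close>, \<open>b\<close> the last column and \<open>r\<close> the last row divided by \<open>c\<close>.\<close>

lemma det_Suc_schur: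
  assumes "a n n \<noteq> (0::'a::field)"
  shows "det (mat (Suc n) (Suc n) (\<lambda>(i,j). a i j)) =
    a n n * det (mat n n (\<lambda>(i,j). schur n a i j))"
proof -
  let ?S = "mat n n (\<lambda>(i,j). schur n a i j)" and ?b = "mat n 1 (\<lambda>(i,j). a i n)"
    and ?r = "mat 1 n (\<lambda>(i,j). a n j / a n n)" and ?c = "mat 1 1 (\<lambda>_. a n n)"
  let ?L = "four_block_mat ?S ?b (0\<^sub>m 1 n) ?c"
    and ?R = "four_block_mat (1\<^sub>m n) (0\<^sub>m n 1) ?r (1\<^sub>m 1)"
  have "mat (Suc n) (Suc n) (\<lambda>(i,j). a i j) =
      four_block_mat (?S + ?b * ?r) ?b (?c * ?r) ?c"
    using assms by (intro eq_matI) (auto simp: scalar_prod_def schur_def four_block_mat_def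
        Let_def not_less less_Suc_eq)
  also have "\<dots> = ?L * ?R"
    by (subst mult_four_block_mat[of _ n n _ 1 _ 1 _ _ n _ 1]) auto
  finally have "det (mat (Suc n) (Suc n) (\<lambda>(i,j). a i j)) = det ?L * det ?R"
    by (simp only:) (rule det_mult[where n = "n + 1"], auto)
  also have "det ?L = det ?S * det ?c"
    by (rule det_four_block_mat_lower_left_zero) auto
  also have "det ?R = det (1\<^sub>m n :: 'a mat) * det (1\<^sub>m 1 :: 'a mat)"
    by (rule det_four_block_mat_upper_right_zero) auto
  also have "det ?c = a n n"
    by (subst det_single) auto
  finally show ?thesis by simp
qed

text \<open>For \<open>q \<noteq> 0\<close> the linear term would dominate at a small \<open>t\<close> of sign opposite to \<open>q\<close>; the explicit
  choice \<open>t = - q / (p + 1)\<close> takes the place of a limit argument, so every ordered field is allowed.\<close>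

lemma linear_term_zero:
  fixes p q :: "'a::linordered_field"
  assumes "\<And>t. 0 \<le> 2 * t * q + t\<^sup>2 * p"
  shows "q = 0"
proof -
  have p: "0 \<le> p" using assms[of 1] assms[of "-1"] by simp
  have "0 \<le> (p + 1)\<^sup>2 * (2 * (- q / (p + 1)) * q + (- q / (p + 1))\<^sup>2 * p)"
    by (intro mult_nonneg_nonneg assms) simp
  also have "\<dots> = - (q\<^sup>2 * (p + 2))"
    using p by (simp add: field_simps power2_eq_square add_nonneg_eq_0_iff)
  finally have "q\<^sup>2 * (p + 2) \<le> 0" by simp
  moreover have "0 \<le> q\<^sup>2 * p" using p by simp
  ultimately have "q\<^sup>2 \<le> 0" by (simp only: distrib_left)
  then show ?thesis by (metis power2_less_eq_zero_iff)
qed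

text \<open>A vanishing diagonal entry makes a basis vector isotropic, and an isotropic vector of a
  semidefinite form lies in its kernel.\<close>

lemma det_zero_if_last_diagonal_zero:
  fixes a :: "nat \<Rightarrow> nat \<Rightarrow> 'a::linordered_field"
  assumes sym: "\<forall>i<n. a i n = a n i"
    and psd: "\<And>x. 0 \<le> qform (Suc n) a x" and "a n n = 0"
  shows "det (mat (Suc n) (Suc n) (\<lambda>(i,j). a i j)) = 0"
proof -
  have z: "a i n = 0" if "i < Suc n" for i
  proof (cases "i = n")
    case False
    with that have i: "i < n" by simp
    show ?thesis
    proof (rule linear_term_zero)
      fix t
      define x :: "nat \<Rightarrow> 'a" where "x = (\<lambda>k. if k = i then t else if k = n then 1 else 0)"
      have pick: "(\<Sum>k<n. x k * r k) = t * r i" for r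
      proof -
        have "(\<Sum>k<n. x k * r k) = (\<Sum>k\<in>{i}. x k * r k)"
          by (rule sum.mono_neutral_right) (use i in \<open>auto simp: x_def\<close>)
        then show ?thesis by (simp add: x_def)
      qed
      have "(\<Sum>j<n. a n j * x j) = a n i * t"
        using pick[of "a n"] by (simp only: mult.commute)
      moreover have "qform n a x = t\<^sup>2 * a i i"
      proof -
        have "qform n a x = (\<Sum>k<n. x k * (\<Sum>j<n. x j * a k j))"
          unfolding qform_def sum_distrib_left by (intro sum.cong refl) (simp only: ac_simps)
        then show ?thesis by (simp only: pick power2_eq_square mult.assoc)
      qed
      moreover have "x n = 1" using i by (simp add: x_def)
      ultimately show "0 \<le> 2 * t * a i n + t\<^sup>2 * a i i"
        using psd[of x] sym i unfolding qform_Suc[OF sym] by (simp add: assms(3) ac_simps)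
    qed
  qed (use assms(3) in simp)
  let ?A = "mat (Suc n) (Suc n) (\<lambda>(i,j). a i j)"
  have "?A *\<^sub>v unit_vec (Suc n) n = 0\<^sub>v (Suc n)"
    by (intro eq_vecI) (auto simp: z)
  moreover have "unit_vec (Suc n) n \<noteq> (0\<^sub>v (Suc n) :: 'a vec)"
  proof
    assume "unit_vec (Suc n) n = (0\<^sub>v (Suc n) :: 'a vec)"
    then have "unit_vec (Suc n) n $ n = (0\<^sub>v (Suc n) :: 'a vec) $ n" by (rule arg_cong)
    then show False by simp
  qed
  ultimately show ?thesis
    by (subst det_0_iff_vec_prod_zero_field[of _ "Suc n"]) (auto intro!: exI[of _ "unit_vec (Suc n) n"])
qed

text \<open>Induction on the size. The value of the Schur complement at \<open>x\<close> is the minimum over \<open>t\<close> of the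
  form at \<open>(x, t)\<close>, so passing to Schur complements preserves \<open>0 \<le> c \<le> a\<close>; the last diagonal
  entries are ordered in the same way, and the determinant is their product with the determinant
  of the Schur complement. This uses no square roots or eigenvalues, which an ordered field need
  not have.\<close>

lemma det_mono:
  fixes a c :: "nat \<Rightarrow> nat \<Rightarrow> 'a::linordered_field"
  assumes "\<And>i j. i < n \<Longrightarrow> j < n \<Longrightarrow> a i j = a j i" "\<And>i j. i < n \<Longrightarrow> j < n \<Longrightarrow> c i j = c j i"
    and "\<And>x. 0 \<le> qform n c x" "\<And>x. qform n c x \<le> qform n a x"
  shows "0 \<le> det (mat n n (\<lambda>(i,j). c i j)) \<and>
    det (mat n n (\<lambda>(i,j). c i j)) \<le> det (mat n n (\<lambda>(i,j). a i j))"
  using assms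
proof (induction n arbitrary: a c)
  case 0
  then show ?case by simp
next
  case (Suc n)
  have a_n: "\<forall>i<n. a i n = a n i" and c_n: "\<forall>i<n. c i n = c n i"
    using Suc.prems(1,2) by auto
  have a_psd: "\<forall>x. 0 \<le> qform (Suc n) a x" and c_psd: "\<forall>x. 0 \<le> qform (Suc n) c x"
    using Suc.prems(3,4) order_trans by blast+
  \<comment> \<open>The last basis vector, which picks out the last diagonal entry.\<close>
  define e :: "nat \<Rightarrow> 'a" where "e = (\<lambda>k. if k = n then 1 else 0)"
  have e: "qform (Suc n) b e = b n n" for b
    by (simp add: qform_def e_def)
  have diag: "0 \<le> c n n" "c n n \<le> a n n"
    using Suc.prems(3,4)[of e] by (simp_all add: e)
  have schur_sym: "schur n b i j = schur n b j i"
    if "\<And>i j. i < Suc n \<Longrightarrow> j < Suc n \<Longrightarrow> b i j = b j i" "i < n" "j < n" for b :: "nat \<Rightarrow> nat \<Rightarrow> 'a" and i j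
    using that(1)[of i j] that(1)[of i n] that(1)[of j n] that(2,3) by (simp add: schur_def)
  have below: "qform n (schur n b) x \<le> qform (Suc n) b (x(n := t))"
    if "b n n > 0" "\<forall>i<n. b i n = b n i" for b :: "nat \<Rightarrow> nat \<Rightarrow> 'a" and x t
    using that(1) qform_complete_square[of n b "x(n := t)", OF that(2)]
      qform_cong[of n x "x(n := t)" "schur n b"] by simp
  have attained: "\<exists>t. qform n (schur n b) x = qform (Suc n) b (x(n := t))"
    if "b n n > 0" "\<forall>i<n. b i n = b n i" for b :: "nat \<Rightarrow> nat \<Rightarrow> 'a" and x
    using that(1) qform_complete_square[of n b "x(n := - (\<Sum>j<n. b n j * x j) / b n n)", OF that(2)]
      qform_cong[of n x "x(n := - (\<Sum>j<n. b n j * x j) / b n n)" "schur n b"]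
    by (intro exI[of _ "- (\<Sum>j<n. b n j * x j) / b n n"]) simp
  have schur_psd: "0 \<le> qform n (schur n b) x"
    if "b n n > 0" "\<forall>i<n. b i n = b n i" "\<forall>x. 0 \<le> qform (Suc n) b x"
    for b :: "nat \<Rightarrow> nat \<Rightarrow> 'a" and x
    using attained[OF that(1,2), of x] that(3) by auto
  show ?case
  proof (cases "a n n = 0")
    case True
    then have "c n n = 0" using diag by simp
    then show ?thesis
      using True det_zero_if_last_diagonal_zero[of n a] det_zero_if_last_diagonal_zero[of n c] a_n c_n a_psd Suc.prems(3)
      by simp
  next
    case False
    then have a_pos: "a n n > 0" using diag by simp
    have Sa: "schur n a i j = schur n a j i" if "i < n" "j < n" for i j
      using schur_sym[OF Suc.prems(1) that] .
    show ?thesis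
    proof (cases "c n n = 0")
      case True
      have "0 \<le> det (mat n n (\<lambda>(i,j). schur n a i j))"
        using Suc.IH[of "schur n a" "schur n a"] Sa schur_psd[OF a_pos a_n a_psd] by simp
      then show ?thesis
        using True det_zero_if_last_diagonal_zero[of n c] c_n Suc.prems(3) a_pos det_Suc_schur[of a n]
        by simp
    next
      case False
      then have c_pos: "c n n > 0" using diag by simp
      have "qform n (schur n c) x \<le> qform n (schur n a) x" for x
      proof -
        obtain t where "qform n (schur n a) x = qform (Suc n) a (x(n := t))"
          using attained[OF a_pos a_n] by blast
        then show ?thesis using below[OF c_pos c_n, of x t] Suc.prems(4)[of "x(n := t)"] by (simp del: fun_upd_apply)
      qed
      then have "0 \<le> det (mat n n (\<lambda>(i,j). schur n c i j)) \<and>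
          det (mat n n (\<lambda>(i,j). schur n c i j)) \<le> det (mat n n (\<lambda>(i,j). schur n a i j))"
        using Suc.IH[of "schur n a" "schur n c"] Sa schur_sym[of c, OF Suc.prems(2)]
          schur_psd[OF c_pos c_n c_psd] by blast
      then show ?thesis
        using a_pos c_pos diag by (auto simp: det_Suc_schur intro!: mult_mono)
    qed
  qed
qed

lemma qform_mat:
  assumes "A \<in> carrier_mat n n" "x \<in> carrier_vec n"
  shows "x \<bullet> (A *\<^sub>v x) = qform n (\<lambda>i j. A $$ (i, j)) (($) x)"
  using assms
  by (auto simp: scalar_prod_def qform_def sum_distrib_left mult.assoc atLeast0LessThan
      intro!: sum.cong)

lemma det_mono_mat:
  fixes A C :: "'a::linordered_field mat"
  assumes A: "A \<in> carrier_mat n n" "transpose_mat A = A"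
    and C: "C \<in> carrier_mat n n" "transpose_mat C = C"
    and psd: "\<And>x. x \<in> carrier_vec n \<Longrightarrow> 0 \<le> x \<bullet> (C *\<^sub>v x)"
    and le: "\<And>x. x \<in> carrier_vec n \<Longrightarrow> x \<bullet> (C *\<^sub>v x) \<le> x \<bullet> (A *\<^sub>v x)"
  shows "0 \<le> det C" "det C \<le> det A"
proof -
  have sym: "B $$ (i, j) = B $$ (j, i)" if "transpose_mat B = B" "B \<in> carrier_mat n n" "i < n" "j < n"
    for B :: "'a mat" and i j
    using that by (metis carrier_matD index_transpose_mat(1))
  have q: "qform n (\<lambda>i j. B $$ (i, j)) x = vec n x \<bullet> (B *\<^sub>v vec n x)"
    if "B \<in> carrier_mat n n" for B :: "'a mat" and x
    using qform_mat[OF that, of "vec n x"] qform_cong[of n x "($) (vec n x)"] by simp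
  have m: "B = mat n n (\<lambda>(i,j). B $$ (i, j))" if "B \<in> carrier_mat n n" for B :: "'a mat"
    using that by auto
  have "0 \<le> det (mat n n (\<lambda>(i,j). C $$ (i, j))) \<and>
      det (mat n n (\<lambda>(i,j). C $$ (i, j))) \<le> det (mat n n (\<lambda>(i,j). A $$ (i, j)))"
    by (rule det_mono) (use sym A C psd le in \<open>auto simp: q\<close>)
  then show "0 \<le> det C" "det C \<le> det A" using m[OF A(1)] m[OF C(1)] by simp_all
qed

text \<open>Choosing \<open>y = A\<inverse> B x\<close> in the bound gives \<open>0 \<le> B\<^sup>T A\<inverse> B \<le> A\<close> as quadratic forms. By
  monotonicity of the determinant \<open>(det B)\<^sup>2 / det A \<le> det A\<close>. If \<open>A\<close> is singular, its kernel is
  contained in that of \<open>B\<close>.\<close>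

theorem det_le_of_form_bound:
  fixes A B :: "'a::linordered_field mat"
  assumes A: "A \<in> carrier_mat n n" "transpose_mat A = A" and B: "B \<in> carrier_mat n n"
    and bound: "\<And>x y. x \<in> carrier_vec n \<Longrightarrow> y \<in> carrier_vec n \<Longrightarrow>
      2 * (y \<bullet> (B *\<^sub>v x)) \<le> x \<bullet> (A *\<^sub>v x) + y \<bullet> (A *\<^sub>v y)"
  shows "det B \<le> det A"
proof -
  have psd: "0 \<le> y \<bullet> (A *\<^sub>v y)" if "y \<in> carrier_vec n" for y
    proof -
    have "B *\<^sub>v 0\<^sub>v n = 0\<^sub>v n" "A *\<^sub>v 0\<^sub>v n = 0\<^sub>v n" using A B by auto
    then show ?thesis using bound[of "0\<^sub>v n" y] that by simp
  qed
  show ?thesis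
  proof (cases "det A = 0")
    case True
    then obtain v where v: "v \<in> carrier_vec n" "v \<noteq> 0\<^sub>v n" "A *\<^sub>v v = 0\<^sub>v n"
      using det_0_iff_vec_prod_zero_field[OF A(1)] by blast
    have Bv: "B *\<^sub>v v \<in> carrier_vec n" using B v by simp
    have "- (w \<bullet> (B *\<^sub>v v)) = 0" if w: "w \<in> carrier_vec n" for w
    proof (rule linear_term_zero)
      fix t
      have "2 * ((t \<cdot>\<^sub>v w) \<bullet> (B *\<^sub>v v)) \<le> v \<bullet> (A *\<^sub>v v) + (t \<cdot>\<^sub>v w) \<bullet> (A *\<^sub>v (t \<cdot>\<^sub>v w))"
        by (rule bound) (use v w in auto)
      then show "0 \<le> 2 * t * - (w \<bullet> (B *\<^sub>v v)) + t\<^sup>2 * (w \<bullet> (A *\<^sub>v w))"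
        using v w A(1) Bv by (simp add: mult_mat_vec power2_eq_square algebra_simps)
    qed
    then have "w \<bullet> (B *\<^sub>v v) = 0" if "w \<in> carrier_vec n" for w using that by simp
    then have "(B *\<^sub>v v) $ i = 0" if "i < n" for i
      using that Bv by (metis scalar_prod_left_unit unit_vec_carrier)
    then have "B *\<^sub>v v = 0\<^sub>v n" using Bv B by (intro eq_vecI) auto
    then have "det B = 0" using det_0_iff_vec_prod_zero_field[OF B] v by blast
    then show ?thesis using True by simp
  next
    case False
    obtain A' where A': "A' \<in> carrier_mat n n" "A * A' = 1\<^sub>m n" "A' * A = 1\<^sub>m n"
      using det_non_zero_imp_unit[OF A(1) False, of "()"] by (auto simp: Units_def ring_mat_def)
    have A'_sym: "transpose_mat A' = A'"
    proof -
      have "transpose_mat A' * A = 1\<^sub>m n"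
        using transpose_mult[OF A(1) A'(1)] A A' by simp
      then have "transpose_mat A' * A * A' = A'" using A' by simp
      then show ?thesis using A A' by (simp add: assoc_mult_mat[of _ n n _ n _ n])
    qed
    define C where "C = transpose_mat B * (A' * B)"
    have C: "C \<in> carrier_mat n n" using A' B by (auto simp: C_def)
    have "transpose_mat C = transpose_mat (A' * B) * B"
      using A' B by (simp add: C_def transpose_mult[of _ n n _ n])
    also have "\<dots> = C"
      using A' B A'_sym by (simp add: C_def transpose_mult[of _ n n _ n] assoc_mult_mat[of _ n n _ n _ n])
    finally have C_sym: "transpose_mat C = C" .
    have key: "0 \<le> x \<bullet> (C *\<^sub>v x)" "x \<bullet> (C *\<^sub>v x) \<le> x \<bullet> (A *\<^sub>v x)" if x: "x \<in> carrier_vec n" for x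
    proof -
      define y where "y = A' *\<^sub>v (B *\<^sub>v x)"
      have y: "y \<in> carrier_vec n" using x A' B by (simp add: y_def)
      have Ay: "A *\<^sub>v y = B *\<^sub>v x"
        using x A A' B by (simp add: y_def assoc_mult_mat_vec[of A n n A' n, symmetric])
      have "C *\<^sub>v x = transpose_mat B *\<^sub>v y"
        using x A' B by (simp add: C_def y_def assoc_mult_mat_vec[of _ n n _ n])
      then have "x \<bullet> (C *\<^sub>v x) = (B *\<^sub>v x) \<bullet> y"
        using transpose_vec_mult_scalar[OF B x y] x y B by (simp add: comm_scalar_prod[of _ n])
      also have "\<dots> = y \<bullet> (B *\<^sub>v x)" using x y B by (simp add: comm_scalar_prod[of _ n])
      finally have *: "x \<bullet> (C *\<^sub>v x) = y \<bullet> (B *\<^sub>v x)" .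
      show "0 \<le> x \<bullet> (C *\<^sub>v x)" using psd[OF y] * Ay by simp
      show "x \<bullet> (C *\<^sub>v x) \<le> x \<bullet> (A *\<^sub>v x)" using bound[OF x y] * Ay by simp
    qed
    have "0 \<le> det A" using det_mono_mat(1)[OF A A psd] by simp
    have "det A * det C = det A * (det B * (det A' * det B))"
      using A' B by (simp add: C_def det_mult[of _ n] det_transpose[of _ n])
    also have "\<dots> = (det A * det A') * (det B)\<^sup>2" by (simp add: power2_eq_square ac_simps)
    also have "det A * det A' = 1" using A A' det_mult[of A n A'] by simp
    finally have "(det B)\<^sup>2 = det A * det C" by simp
    also have "\<dots> \<le> det A * det A"
      using \<open>0 \<le> det A\<close> det_mono_mat(2)[OF A C C_sym key] by (simp add: mult_left_mono)
    finally show ?thesis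
      using \<open>0 \<le> det A\<close> by (auto simp: power2_eq_square[symmetric] intro: power2_le_imp_le)
  qed
qed


section \<open>Coefficientwise maps of series\<close>

lemma hcoeff_hmap: "h 0 = 0 \<Longrightarrow> hcoeff (hmap h f) q = h (hcoeff f q)"
  by (simp add: hmap.rep_eq)

lemma hsupp_hmap: "hsupp (hmap h f) \<subseteq> hsupp f"
  by (auto simp: hsupp_def hmap.rep_eq)

lemma hmap_add:
  assumes "h 0 = 0" "\<And>a b. h (a + b) = h a + h b"
  shows "hmap h (f + g) = hmap h f + hmap h g"
  by (rule hahn_eqI) (simp add: hcoeff_hmap plus_hahn.rep_eq assms)

lemma hmap_zero: "hmap h 0 = 0"
  by (rule hahn_eqI) (simp add: hmap.rep_eq zero_hahn.rep_eq)

lemma hmap_monom: "h 0 = 0 \<Longrightarrow> hmap h (hmonom q a) = hmonom q (h a)"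
  by (rule hahn_eqI) (simp add: hcoeff_hmap hmonom.rep_eq)

lemma hmap_hconv:
  fixes B :: "'a::zero \<Rightarrow> 'b::zero \<Rightarrow> 'c::comm_monoid_add"
    and B' :: "'a'::zero \<Rightarrow> 'b'::zero \<Rightarrow> 'c'::comm_monoid_add"
  assumes h: "h 0 = 0" "\<And>a b. h (a + b) = h a + h b" "\<And>a b. h (B a b) = B' (u a) (v b)"
    and uv: "u 0 = 0" "v 0 = 0" and B: "\<And>x. B 0 x = 0" "\<And>x. B x 0 = 0"
      "\<And>x. B' 0 x = 0" "\<And>x. B' x 0 = 0"
  shows "hmap h (hconv B f g) = hconv B' (hmap u f) (hmap v g)"
proof (rule hahn_eqI)
  fix q
  have h_sum: "h (sum F S) = (\<Sum>p\<in>S. h (F p))" for F :: "rat \<Rightarrow> 'c" and S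
    by (induction S rule: infinite_finite_induct) (auto simp: h)
  have "hcoeff (hmap h (hconv B f g)) q =
      (\<Sum>p | p \<in> hsupp f \<and> q - p \<in> hsupp g. B' (hcoeff (hmap u f) p) (hcoeff (hmap v g) (q - p)))"
    by (subst hcoeff_hmap, fact, subst hcoeff_hconv[of "hsupp f" "hsupp g"])
      (auto simp: well_ordered_hsupp B h_sum h hcoeff_hmap uv)
  also have "\<dots> = hcoeff (hconv B' (hmap u f) (hmap v g)) q"
    by (rule hcoeff_hconv[symmetric])
      (simp_all add: well_ordered_hsupp B hsupp_hmap)
  finally show "hcoeff (hmap h (hconv B f g)) q = hcoeff (hconv B' (hmap u f) (hmap v g)) q" .
qed

lemma hmap_times:
  fixes f g :: "'a::comm_ring_1 hahn" and h :: "'a \<Rightarrow> 'b::comm_ring_1"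
  assumes "h 0 = 0" "\<And>a b. h (a + b) = h a + h b" "\<And>a b. h (a * b) = h a * h b"
  shows "hmap h (f * g) = hmap h f * hmap h g"
  unfolding times_hahn_def by (rule hmap_hconv) (use assms in auto)

section \<open>Real series, conjugation and the constants\<close>

interpretation hreal: inj_comm_ring_hom hreal
proof
  show "hreal (x + y) = hreal x + hreal y" for x y
    unfolding hreal_def by (rule hmap_add) auto
  show "hreal (x * y) = hreal x * hreal y" for x y
    unfolding hreal_def by (rule hmap_times) auto
  show "hreal 1 = 1" unfolding hreal_def one_hahn_def by (subst hmap_monom) auto
  show "hreal 0 = 0" unfolding hreal_def by (rule hmap_zero)
  show "x = 0" if "hreal x = 0" for x
  proof (rule hahn_eqI)
    fix q
    have "hcoeff (hreal x) q = 0" using that by (simp add: zero_hahn.rep_eq)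
    then show "hcoeff x q = hcoeff 0 q"
      by (simp add: hreal_def hcoeff_hmap zero_hahn.rep_eq)
  qed
qed

definition hcnj :: "complex hahn \<Rightarrow> complex hahn" where
  "hcnj = hmap cnj"

lemma hcnj_mult: "hcnj (a * b) = hcnj a * hcnj b"
  unfolding hcnj_def by (rule hmap_times) auto

lemma hcnj_hreal [simp]: "hcnj (hreal x) = hreal x"
  by (rule hahn_eqI) (simp add: hcnj_def hreal_def hcoeff_hmap)

lemma hcnj_hi: "hcnj hi = - hi"
  by (rule hahn_eqI) (simp add: hcnj_def hi_def hcoeff_hmap hmonom.rep_eq uminus_hahn.rep_eq)

lemma hmonom_mult: "hmonom p a * hmonom q b = hmonom (p + q) (a * b :: 'a::comm_ring_1)"
proof (rule hahn_eqI)
  fix r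
  have "hcoeff (hmonom p a * hmonom q b) r =
      (\<Sum>s | s \<in> {p} \<and> r - s \<in> {q}. hcoeff (hmonom p a) s * hcoeff (hmonom q b) (r - s))"
    by (rule hcoeff_times) (auto simp: well_ordered_set_finite dest: hsupp_monom[THEN subsetD])
  also have "{s. s \<in> {p} \<and> r - s \<in> {q}} = (if r = p + q then {p} else {})" by auto
  finally show "hcoeff (hmonom p a * hmonom q b) r = hcoeff (hmonom (p + q) (a * b)) r"
    by (auto simp: hmonom.rep_eq)
qed

lemma hi_squared: "hi * hi = - 1"
  unfolding hi_def hmonom_mult
  by (rule hahn_eqI) (simp add: hmonom.rep_eq one_hahn_def uminus_hahn.rep_eq)

lemma hi_nonzero: "hi \<noteq> 0"
proof
  assume "hi = 0"
  then show False using hi_squared by simp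
qed

lemma hbar_nonzero: "hbar \<noteq> 0"
proof
  assume "hbar = 0"
  then have "hcoeff hbar 1 = 0" by (simp add: zero_hahn.rep_eq)
  then show False by (simp add: hbar_def hmonom.rep_eq)
qed

section \<open>Evaluation at a point\<close>

text \<open>Evaluation of all coefficients at a point is additive, turns the scalar action into multiplication
  of series and the involution into conjugation. Points separate series of functions, so module
  identities follow from ring identities for \<open>complex hahn\<close>.\<close>

definition heval :: "'m \<Rightarrow> ('m \<Rightarrow> complex) hahn \<Rightarrow> complex hahn" where
  "heval p = hmap (\<lambda>f. f p)"

lemma heval_eqI: assumes "\<And>p. heval p f = heval p g" shows "f = g"
proof (rule hahn_eqI, rule ext)
  fix q p
  have "hcoeff (heval p f) q = hcoeff (heval p g) q" using assms by simp
  then show "hcoeff f q p = hcoeff g q p" by (simp add: heval_def hcoeff_hmap)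
qed

lemma heval_add [simp]: "heval p (f + g) = heval p f + heval p g"
  unfolding heval_def by (rule hmap_add) auto

lemma heval_minus [simp]: "heval p (f - g) = heval p f - heval p g"
  by (rule hahn_eqI) (simp add: heval_def hcoeff_hmap minus_hahn.rep_eq)

lemma heval_zero [simp]: "heval p 0 = 0"
  unfolding heval_def by (rule hmap_zero)

lemma heval_hscale [simp]: "heval p (a \<bullet>\<^sub>h f) = a * heval p f"
proof -
  have id: "hmap (\<lambda>x. x) a = a" by (rule hahn_eqI) (simp add: hcoeff_hmap)
  have "heval p (a \<bullet>\<^sub>h f) = hconv (*) (hmap (\<lambda>x. x) a) (heval p f)"
    unfolding heval_def hscale_def by (rule hmap_hconv) (auto simp: zero_fun_def)
  then show ?thesis by (simp add: id times_hahn_def)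
qed

lemma heval_hconj [simp]: "heval p (hconj f) = hcnj (heval p f)"
proof (rule hahn_eqI)
  have "(\<lambda>x::'a. cnj ((0::'a \<Rightarrow> complex) x)) = 0" by auto
  then show "hcoeff (heval p (hconj f)) q = hcoeff (hcnj (heval p f)) q" for q
    by (simp add: heval_def hconj_def hcnj_def hcoeff_hmap)
qed

lemma hcnj_add: "hcnj (a + b) = hcnj a + hcnj b"
  unfolding hcnj_def by (rule hmap_add) auto

lemma hconj_add: "hconj (f + g) = hconj f + hconj g"
  by (rule heval_eqI) (simp add: hcnj_add)

lemma hconj_hscale: "hconj (a \<bullet>\<^sub>h f) = hcnj a \<bullet>\<^sub>h hconj f"
  by (rule heval_eqI) (simp add: hcnj_mult)

lemma hconj_zero: "hconj 0 = 0"
  unfolding hconj_def by (rule hmap_zero)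

lemma hconj_one: "hconj (one_series M) = one_series M"
proof -
  have "(\<lambda>x. cnj (one_fun M x)) = one_fun M"
    by (auto simp: one_fun_def indicator_def)
  then show ?thesis
    unfolding hconj_def one_series_def by (subst hmap_monom) auto
qed

section \<open>Smooth functions form a vector space\<close>

text \<open>Representatives \<open>f \<circ> inv_into U \<phi>\<close> have no useful shape outside the chart image, so all rules for
  \<open>ck_on\<close> must be local on an open set.\<close>

lemma ck_on_cong:
  assumes "open S" "\<And>x. x \<in> S \<Longrightarrow> f x = g x"
  shows "ck_on k S f \<longleftrightarrow> ck_on k S g"
proof -
  have "ck_on k S g" if "ck_on k S f" "\<And>x. x \<in> S \<Longrightarrow> f x = g x" for f g :: "'a \<Rightarrow> 'b"
    using that
  proof (induction k arbitrary: f g)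
    case 0
    then show ?case using continuous_on_cong[of S S f g] by simp
  next
    case (Suc k)
    have d: "(g has_derivative frechet_derivative f (at x)) (at x)" if x: "x \<in> S" for x
      using Suc.prems(1) x
      by (intro has_derivative_transform_within_open[OF _ assms(1) x Suc.prems(2)])
        (simp_all add: frechet_derivative_works[symmetric])
    have "frechet_derivative f (at x) v = frechet_derivative g (at x) v" if "x \<in> S" for x v
      by (rule fun_cong[OF frechet_derivative_at[OF d[OF that]]])
    then have "ck_on k S (\<lambda>x. frechet_derivative g (at x) v)" for v
      by (rule Suc.IH[rotated]) (use Suc.prems(1) in simp_all)
    then show ?case using d by (auto simp: differentiable_def)
  qed
  from this[of f g] this[of g f] show ?thesis using assms(2) by auto
qed

lemma ck_on_const: "ck_on k S (\<lambda>x. c)"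
proof (induction k arbitrary: c)
  case (Suc k)
  have "frechet_derivative (\<lambda>x::'a. c) (at x) = (\<lambda>v. 0)" for x
    by (rule frechet_derivative_at[symmetric]) simp
  then show ?case using Suc by simp
qed simp

lemma ck_on_add:
  assumes "open S" "ck_on k S f" "ck_on k S g"
  shows "ck_on k S (\<lambda>x. f x + g x)"
  using assms(2,3)
proof (induction k arbitrary: f g)
  case 0
  then show ?case by (simp add: continuous_on_add)
next
  case (Suc k)
  have D: "((\<lambda>x. f x + g x) has_derivative
      (\<lambda>v. frechet_derivative f (at x) v + frechet_derivative g (at x) v)) (at x)" if "x \<in> S" for x
    using Suc.prems that by (intro has_derivative_add) (simp_all add: frechet_derivative_works[symmetric])
  have "ck_on k S (\<lambda>x. frechet_derivative (\<lambda>x. f x + g x) (at x) v)" for v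
  proof -
    have "ck_on k S (\<lambda>x. frechet_derivative f (at x) v + frechet_derivative g (at x) v)"
      using Suc.IH[of "\<lambda>x. frechet_derivative f (at x) v" "\<lambda>x. frechet_derivative g (at x) v"] Suc.prems
      by simp
    then show ?thesis
      by (rule ck_on_cong[OF assms(1), THEN iffD1, rotated])
        (rule fun_cong[OF frechet_derivative_at[OF D]])
  qed
  then show ?case using D by (auto simp: differentiable_def)
qed

lemma ck_on_mult_left:
  fixes f :: "'a::real_normed_vector \<Rightarrow> 'b::real_normed_algebra"
  assumes "open S" "ck_on k S f"
  shows "ck_on k S (\<lambda>x. c * f x)"
  using assms(2)
proof (induction k arbitrary: f)
  case 0
  then show ?case by (simp add: continuous_on_mult_left)
next
  case (Suc k)
  have D: "((\<lambda>x. c * f x) has_derivative (\<lambda>v. c * frechet_derivative f (at x) v)) (at x)"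
    if "x \<in> S" for x
    using Suc.prems that by (intro has_derivative_mult_right) (simp add: frechet_derivative_works[symmetric])
  have "ck_on k S (\<lambda>x. frechet_derivative (\<lambda>x. c * f x) (at x) v)" for v
  proof -
    have "ck_on k S (\<lambda>x. c * frechet_derivative f (at x) v)"
      using Suc.IH[of "\<lambda>x. frechet_derivative f (at x) v"] Suc.prems by simp
    then show ?thesis
      by (rule ck_on_cong[OF assms(1), THEN iffD1, rotated])
        (rule fun_cong[OF frechet_derivative_at[OF D]])
  qed
  then show ?case using D by (auto simp: differentiable_def)
qed

context smooth_manifold
begin

lemma smooth_funsI:
  assumes "\<And>p. p \<notin> topspace M \<Longrightarrow> f p = 0"
    and "\<And>U \<phi> k. (U, \<phi>) \<in> \<A> \<Longrightarrow> ck_on k (\<phi> ` U) (\<lambda>x. f (inv_into U \<phi> x))"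
  shows "f \<in> smooth_funs M \<A>"
proof -
  have "\<forall>c\<in>\<A>. case c of (U, \<phi>) \<Rightarrow> smooth_on (\<phi> ` U) (f \<circ> inv_into U \<phi>)"
    using assms(2) by (auto simp: smooth_on_def comp_def)
  then show ?thesis using assms(1) by (simp add: smooth_funs_def)
qed

lemma smooth_funsD:
  assumes "f \<in> smooth_funs M \<A>"
  shows "p \<notin> topspace M \<Longrightarrow> f p = 0"
    and "(U, \<phi>) \<in> \<A> \<Longrightarrow> ck_on k (\<phi> ` U) (\<lambda>x. f (inv_into U \<phi> x))"
proof -
  show "p \<notin> topspace M \<Longrightarrow> f p = 0" using assms by (simp add: smooth_funs_def)
  assume "(U, \<phi>) \<in> \<A>"
  then have "smooth_on (\<phi> ` U) (f \<circ> inv_into U \<phi>)"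
    using assms bspec[of \<A> "\<lambda>(U, \<phi>). smooth_on (\<phi> ` U) (f \<circ> inv_into U \<phi>)" "(U, \<phi>)"]
    by (simp add: smooth_funs_def)
  then show "ck_on k (\<phi> ` U) (\<lambda>x. f (inv_into U \<phi> x))"
    by (simp add: smooth_on_def comp_def)
qed

lemma one_fun_smooth: "one_fun M \<in> smooth_funs M \<A>"
proof (rule smooth_funsI)
  fix U \<phi> k assume c: "(U, \<phi>) \<in> \<A>"
  have "U \<subseteq> topspace M" using chart_domain[OF c] openin_subset by blast
  then have "one_fun M (inv_into U \<phi> x) = 1" if "x \<in> \<phi> ` U" for x
    using inv_into_into[OF that] by (auto simp: one_fun_def)
  then show "ck_on k (\<phi> ` U) (\<lambda>x. one_fun M (inv_into U \<phi> x))"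
    using ck_on_cong[OF chart_image[OF c], of "\<lambda>x. one_fun M (inv_into U \<phi> x)" "\<lambda>_. 1"]
      ck_on_const by blast
qed (simp add: one_fun_def)

lemma zero_smooth: "0 \<in> smooth_funs M \<A>"
  by (rule smooth_funsI) (simp_all add: ck_on_const)

lemma add_smooth:
  assumes "f \<in> smooth_funs M \<A>" "g \<in> smooth_funs M \<A>"
  shows "f + g \<in> smooth_funs M \<A>"
proof (rule smooth_funsI)
  fix U \<phi> k assume c: "(U, \<phi>) \<in> \<A>"
  show "ck_on k (\<phi> ` U) (\<lambda>x. (f + g) (inv_into U \<phi> x))"
    using ck_on_add[OF chart_image[OF c] smooth_funsD(2)[OF assms(1) c] smooth_funsD(2)[OF assms(2) c]]
    by simp
qed (simp add: smooth_funsD(1)[OF assms(1)] smooth_funsD(1)[OF assms(2)])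

lemma scale_smooth:
  assumes "f \<in> smooth_funs M \<A>"
  shows "(\<lambda>x. c * f x) \<in> smooth_funs M \<A>"
proof (rule smooth_funsI)
  fix U \<phi> k assume a: "(U, \<phi>) \<in> \<A>"
  show "ck_on k (\<phi> ` U) (\<lambda>x. c * f (inv_into U \<phi> x))"
    by (rule ck_on_mult_left[OF chart_image[OF a] smooth_funsD(2)[OF assms a]])
qed (simp add: smooth_funsD(1)[OF assms])

lemma zero_series: "0 \<in> smooth_series M \<A>"
  by (simp add: smooth_series_def zero_hahn.rep_eq zero_smooth)

lemma one_series_smooth: "one_series M \<in> smooth_series M \<A>"
  using zero_smooth by (simp add: smooth_series_def one_series_def hmonom.rep_eq one_fun_smooth)

lemma add_series: "f \<in> smooth_series M \<A> \<Longrightarrow> g \<in> smooth_series M \<A> \<Longrightarrow> f + g \<in> smooth_series M \<A>"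
  by (simp add: smooth_series_def plus_hahn.rep_eq add_smooth)

lemma hscale_series:
  assumes "f \<in> smooth_series M \<A>"
  shows "a \<bullet>\<^sub>h f \<in> smooth_series M \<A>"
proof -
  have sum: "sum F S \<in> smooth_funs M \<A>" if "\<And>p. F p \<in> smooth_funs M \<A>"
    for F :: "rat \<Rightarrow> 'm \<Rightarrow> complex" and S
  proof (induction S rule: infinite_finite_induct)
    case (insert p S)
    then show ?case by (simp only: sum.insert add_smooth[OF that] not_False_eq_True)
  qed (simp_all add: zero_smooth[unfolded zero_fun_def] zero_fun_def)
  have "hcoeff (a \<bullet>\<^sub>h f) q \<in> smooth_funs M \<A>" for q
    unfolding hscale_def hconv.rep_eq
    by (rule sum, rule scale_smooth) (use assms in \<open>simp add: smooth_series_def\<close>)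
  then show ?thesis by (simp add: smooth_series_def)
qed

end



section \<open>The correlation form of a state\<close>

lemma two_nonzero [simp]: "(2 :: complex hahn) \<noteq> 0"
proof -
  have "hreal 1 + hreal 1 \<noteq> 0" unfolding hreal.hom_add[symmetric] hreal.hom_0_iff by simp
  then show ?thesis by (simp only: hreal.hom_one one_add_one simp_thms)
qed

lemma hreal_range_closed:
  assumes "a \<in> range hreal" "b \<in> range hreal"
  shows "a + b \<in> range hreal" "a - b \<in> range hreal" "- a \<in> range hreal"
    "a / 2 \<in> range hreal"
proof -
  obtain x y where xy: "a = hreal x" "b = hreal y" using assms by blast
  show "a + b \<in> range hreal" "a - b \<in> range hreal" "- a \<in> range hreal"
    by (auto simp: xy simp flip: hreal.hom_add hreal.hom_minus hreal.hom_uminus)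
  have "a = 2 * hreal (x / 2)"
  proof -
    have "2 * hreal (x / 2) = hreal (x / 2 + x / 2)" by (simp only: hreal.hom_add mult_2)
    then show ?thesis by (simp add: xy)
  qed
  then have "a / 2 = hreal (x / 2)" by simp
  then show "a / 2 \<in> range hreal" by (simp only: rangeI)
qed

lemma hle_zero_hreal: "0 \<preceq> hreal x \<longleftrightarrow> 0 \<le> x"
  unfolding hle_def by (metis hreal.hom_zero hreal.eq_iff)

definition comb :: "(nat \<Rightarrow> complex hahn) \<Rightarrow> (nat \<Rightarrow> ('m \<Rightarrow> complex) hahn) \<Rightarrow> nat \<Rightarrow> ('m \<Rightarrow> complex) hahn" where
  "comb c F n = (\<Sum>j<n. c j \<bullet>\<^sub>h F j)"

lemma comb_simps [simp]:
  "comb c F 0 = 0"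
  "comb c F (Suc n) = c n \<bullet>\<^sub>h F n + comb c F n"
  by (simp_all add: comb_def add.commute)

lemma sum_nonzero_only_zero:
  fixes F :: "nat \<Rightarrow> 'a::comm_monoid_add"
  assumes "\<And>k. k \<noteq> 0 \<Longrightarrow> F k = 0"
  shows "(\<Sum>k | F k \<noteq> 0. F k) = F 0"
proof (cases "F 0 = 0")
  case True
  then have "{k. F k \<noteq> 0} = {}" using assms by (metis (mono_tags, lifting) empty_Collect_eq)
  then show ?thesis using True by (simp only: sum.empty)
next
  case False
  then have "{k. F k \<noteq> 0} = {0}" using assms by auto
  then show ?thesis by simp
qed

locale star_state_space = smooth_manifold M \<A>
  for M :: "'m topology" and \<A> :: "('m, 'e::real_normed_vector) chart set" +
  fixes \<omega> :: "('m, 'e) chart \<Rightarrow> 'm \<Rightarrow> 'e \<Rightarrow> 'e \<Rightarrow> real"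
    and star :: "('m \<Rightarrow> complex) hahn \<Rightarrow> ('m \<Rightarrow> complex) hahn \<Rightarrow> ('m \<Rightarrow> complex) hahn"
    and \<rho> :: "('m \<Rightarrow> complex) hahn \<Rightarrow> complex hahn"
  assumes star: "star_product M \<A> \<omega> star"
    and state: "star_state M \<A> star \<rho>"
begin

lemma star_closed:
  "f \<in> smooth_series M \<A> \<Longrightarrow> g \<in> smooth_series M \<A> \<Longrightarrow> star f g \<in> smooth_series M \<A>"
  using star unfolding star_product_def by blast

lemma star_linear:
  assumes "f \<in> smooth_series M \<A>" "g \<in> smooth_series M \<A>" "h \<in> smooth_series M \<A>"
  shows "star (a \<bullet>\<^sub>h f + g) h = a \<bullet>\<^sub>h star f h + star g h"
    and "star h (a \<bullet>\<^sub>h f + g) = a \<bullet>\<^sub>h star h f + star h g"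
  using star assms unfolding star_product_def by blast+

lemma state_linear:
  assumes "f \<in> smooth_series M \<A>" "g \<in> smooth_series M \<A>"
  shows "\<rho> (a \<bullet>\<^sub>h f + g) = a * \<rho> f + \<rho> g"
  using state assms unfolding star_state_def by blast

lemma state_positive: "f \<in> smooth_series M \<A> \<Longrightarrow> 0 \<preceq> \<rho> (star (hconj f) f)"
  using state unfolding star_state_def by blast

lemma state_one: "\<rho> (one_series M) = 1"
  using state unfolding star_state_def by blast

lemma one_fun_mult: "f \<in> smooth_funs M \<A> \<Longrightarrow> (\<lambda>p. one_fun M p * f p) = f"
  using smooth_funsD(1)[of f] by (fastforce simp: one_fun_def indicator_def)

lemma hconv_one:
  fixes B :: "('m \<Rightarrow> complex) \<Rightarrow> ('m \<Rightarrow> complex) \<Rightarrow> ('m \<Rightarrow> complex)"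
  assumes f: "f \<in> smooth_series M \<A>"
  shows "hcoeff (hconv B (one_series M) f) q = (if hcoeff f q = 0 then 0 else B (one_fun M) (hcoeff f q))"
    and "hcoeff (hconv B f (one_series M)) q = (if hcoeff f q = 0 then 0 else B (hcoeff f q) (one_fun M))"
proof -
  have one: "one_fun M \<noteq> 0" if "hcoeff f q \<noteq> 0"
  proof
    assume "one_fun M = 0"
    then have "hcoeff f q = 0"
      using one_fun_mult[of "hcoeff f q"] f by (simp add: smooth_series_def zero_fun_def)
    then show False using that by simp
  qed
  have "{p. hcoeff (one_series M) p \<noteq> 0 \<and> hcoeff f (q - p) \<noteq> 0} = (if hcoeff f q = 0 then {} else {0})"
    using one by (auto simp: one_series_def hmonom.rep_eq split: if_splits)
  then show "hcoeff (hconv B (one_series M) f) q = (if hcoeff f q = 0 then 0 else B (one_fun M) (hcoeff f q))"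
    unfolding hconv.rep_eq by (simp add: one_series_def hmonom.rep_eq)
  have "{p. hcoeff f p \<noteq> 0 \<and> hcoeff (one_series M) (q - p) \<noteq> 0} = (if hcoeff f q = 0 then {} else {q})"
    using one by (auto simp: one_series_def hmonom.rep_eq split: if_splits)
  then show "hcoeff (hconv B f (one_series M)) q = (if hcoeff f q = 0 then 0 else B (hcoeff f q) (one_fun M))"
    unfolding hconv.rep_eq by (simp add: one_series_def hmonom.rep_eq)
qed

text \<open>The operators \<open>C\<^sub>k\<close> with \<open>k \<ge> 1\<close> annihilate constants, so only \<open>C\<^sub>0\<close>, the pointwise product,
  contributes.\<close>

lemma star_one:
  assumes f: "f \<in> smooth_series M \<A>"
  shows "star (one_series M) f = f" "star f (one_series M) = f"
proof -
  obtain C :: "nat \<Rightarrow> ('m \<Rightarrow> complex) \<Rightarrow> ('m \<Rightarrow> complex) \<Rightarrow> 'm \<Rightarrow> complex" where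
    C0: "\<forall>f\<in>smooth_funs M \<A>. \<forall>g\<in>smooth_funs M \<A>. C 0 f g = (\<lambda>p. f p * g p)" and
    Ck: "\<forall>k\<ge>1. \<forall>f\<in>smooth_funs M \<A>. C k (one_fun M) f = 0 \<and> C k f (one_fun M) = 0" and
    series: "\<forall>f\<in>smooth_series M \<A>. \<forall>g\<in>smooth_series M \<A>. \<forall>q. hcoeff (star f g) q =
      (\<Sum>k | hcoeff (hconv (C k) f g) (q - of_nat k) \<noteq> 0. hcoeff (hconv (C k) f g) (q - of_nat k))"
    using star unfolding star_product_def by blast
  have fq: "hcoeff f q \<in> smooth_funs M \<A>" for q using f by (simp add: smooth_series_def)
  have Ck': "C k (one_fun M) (hcoeff f q) = 0" "C k (hcoeff f q) (one_fun M) = 0" if "k \<noteq> 0" for k q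
    using Ck fq that by auto
  have C0': "C 0 (one_fun M) (hcoeff f q) = hcoeff f q" "C 0 (hcoeff f q) (one_fun M) = hcoeff f q" for q
    using C0 fq one_fun_smooth one_fun_mult[OF fq, of q] by (simp_all add: mult.commute)
  show "star (one_series M) f = f"
  proof (rule hahn_eqI)
    fix q
    have "hcoeff (star (one_series M) f) q =
        hcoeff (hconv (C 0) (one_series M) f) (q - of_nat 0)"
      unfolding series[rule_format, OF one_series_smooth f]
      by (rule sum_nonzero_only_zero) (simp add: hconv_one(1)[OF f] Ck')
    then show "hcoeff (star (one_series M) f) q = hcoeff f q"
      by (simp add: hconv_one(1)[OF f] C0')
  qed
  show "star f (one_series M) = f"
  proof (rule hahn_eqI)
    fix q
    have "hcoeff (star f (one_series M)) q =
        hcoeff (hconv (C 0) f (one_series M)) (q - of_nat 0)"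
      unfolding series[rule_format, OF f one_series_smooth]
      by (rule sum_nonzero_only_zero) (simp add: hconv_one(2)[OF f] Ck')
    then show "hcoeff (star f (one_series M)) q = hcoeff f q"
      by (simp add: hconv_one(2)[OF f] C0')
  qed
qed

definition corr :: "('m \<Rightarrow> complex) hahn \<Rightarrow> ('m \<Rightarrow> complex) hahn \<Rightarrow> complex hahn" where
  "corr f g = \<rho> (star f g)"

lemma corr_linear:
  assumes "f \<in> smooth_series M \<A>" "g \<in> smooth_series M \<A>" "h \<in> smooth_series M \<A>"
  shows "corr (a \<bullet>\<^sub>h f + g) h = a * corr f h + corr g h"
    and "corr h (a \<bullet>\<^sub>h f + g) = a * corr h f + corr h g"
  unfolding corr_def star_linear[OF assms]
  by (rule state_linear; rule star_closed; rule assms)+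

lemma hscale_one: "1 \<bullet>\<^sub>h f = f"
  by (rule heval_eqI) simp

lemma corr_zero:
  assumes "f \<in> smooth_series M \<A>"
  shows "corr 0 f = 0" "corr f 0 = 0"
proof -
  have "corr 0 f = corr 0 f + corr 0 f" "corr f 0 = corr f 0 + corr f 0"
    using corr_linear[OF zero_series zero_series assms, of 1]
    unfolding hscale_one add_0_right mult_1_left by simp_all
  then show "corr 0 f = 0" "corr f 0 = 0" by (simp_all only: add_cancel_right_right)
qed

lemma corr_add:
  assumes "f \<in> smooth_series M \<A>" "g \<in> smooth_series M \<A>" "h \<in> smooth_series M \<A>"
  shows "corr (f + g) h = corr f h + corr g h" "corr h (f + g) = corr h f + corr h g"
  using corr_linear[OF assms, of 1] by (simp_all add: hscale_one)

lemma state_add: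
  "f \<in> smooth_series M \<A> \<Longrightarrow> g \<in> smooth_series M \<A> \<Longrightarrow> \<rho> (f + g) = \<rho> f + \<rho> g"
  using state_linear[of f g 1] by (simp add: hscale_one)

lemma corr_one:
  assumes "f \<in> smooth_series M \<A>"
  shows "corr (one_series M) f = \<rho> f" "corr f (one_series M) = \<rho> f"
  by (simp_all add: corr_def star_one[OF assms])


lemma comb_series:
  "(\<And>j. j < n \<Longrightarrow> F j \<in> smooth_series M \<A>) \<Longrightarrow> comb c F n \<in> smooth_series M \<A>"
  by (induction n) (simp_all add: zero_series add_series hscale_series)

lemma hconj_comb:
  "(\<And>j. j < n \<Longrightarrow> hconj (F j) = F j) \<Longrightarrow> (\<And>j. hcnj (c j) = c j) \<Longrightarrow> hconj (comb c F n) = comb c F n"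
  by (induction n) (simp_all add: hconj_zero hconj_add hconj_hscale)

lemma corr_comb_left:
  assumes "\<And>j. j < n \<Longrightarrow> F j \<in> smooth_series M \<A>" "g \<in> smooth_series M \<A>"
  shows "corr (comb c F n) g = (\<Sum>j<n. c j * corr (F j) g)"
  using assms(1)
  by (induction n) (simp_all add: corr_zero assms(2) corr_linear comb_series)

lemma corr_comb_right:
  assumes "\<And>j. j < n \<Longrightarrow> F j \<in> smooth_series M \<A>" "g \<in> smooth_series M \<A>"
  shows "corr g (comb c F n) = (\<Sum>j<n. c j * corr g (F j))"
  using assms(1)
  by (induction n) (simp_all add: corr_zero assms(2) corr_linear comb_series)

lemma corr_comb:
  assumes "\<And>j. j < n \<Longrightarrow> F j \<in> smooth_series M \<A>"
  shows "corr (comb c F n) (comb d F n) = (\<Sum>j<n. \<Sum>k<n. c j * corr (F j) (F k) * d k)"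
proof -
  have "corr (comb c F n) (comb d F n) = (\<Sum>j<n. c j * corr (F j) (comb d F n))"
    by (rule corr_comb_left[OF assms comb_series[OF assms]])
  also have "\<dots> = (\<Sum>j<n. c j * (\<Sum>k<n. d k * corr (F j) (F k)))"
    using corr_comb_right[OF assms] assms by simp
  finally show ?thesis by (simp add: sum_distrib_left ac_simps)
qed

section \<open>Positivity and reality of correlations\<close>

text \<open>Positivity of the state at \<open>f + i g\<close>.\<close>

lemma corr_complex_square:
  assumes f: "f \<in> smooth_series M \<A>" and g: "g \<in> smooth_series M \<A>"
    and sa: "hconj f = f" "hconj g = g"
  shows "0 \<preceq> corr f f + corr g g + hi * (corr f g - corr g f)"
proof -
  define u where "u = hi \<bullet>\<^sub>h g + f"
  have u: "u \<in> smooth_series M \<A>" using f g by (simp add: u_def add_series hscale_series)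
  have "hconj u = (- hi) \<bullet>\<^sub>h g + f"
    by (simp add: u_def hconj_add hconj_hscale sa hcnj_hi)
  then have "corr (hconj u) u = - hi * corr g u + corr f u"
    by (simp add: corr_linear(1)[OF g f u])
  also have "\<dots> = - hi * (hi * corr g g + corr g f) + (hi * corr f g + corr f f)"
    using corr_linear(2)[OF g f] f g by (simp add: u_def)
  also have "\<dots> = - (hi * hi) * corr g g + corr f f + hi * (corr f g - corr g f)"
    by (simp add: algebra_simps)
  finally have "corr (hconj u) u = corr f f + corr g g + hi * (corr f g - corr g f)"
    by (simp add: hi_squared)
  then show ?thesis using state_positive[OF u] by (simp add: corr_def)
qed

lemma corr_self_real:
  assumes "f \<in> smooth_series M \<A>" "hconj f = f"
  shows "corr f f \<in> range hreal"
  using state_positive[OF assms(1)] assms(2) by (auto simp: corr_def hle_def)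

text \<open>Polarization: positivity makes \<open>corr\<close> real on the diagonal at \<open>f\<close>, \<open>g\<close> and \<open>f + g\<close>. The lemma after
  it uses \<open>f + i g\<close> in the same way. Together they say that \<open>corr\<close> is Hermitian on self-adjoint
  elements: half the symmetrization is its real part, and half the commutator is \<open>i\<close> times its
  imaginary part.\<close>

lemma corr_symmetric_real:
  assumes "f \<in> smooth_series M \<A>" "g \<in> smooth_series M \<A>" "hconj f = f" "hconj g = g"
  shows "corr f g + corr g f \<in> range hreal"
proof -
  have "corr (f + g) (f + g) - corr f f - corr g g = corr f g + corr g f"
    using assms(1,2) by (simp add: corr_add add_series)
  then show ?thesis
    using hreal_range_closed(2)[OF hreal_range_closed(2)[OF corr_self_real[of "f + g"]
          corr_self_real[of f]] corr_self_real[of g]] assms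
    by (simp add: add_series hconj_add)
qed

lemma corr_skew_real:
  assumes "f \<in> smooth_series M \<A>" "g \<in> smooth_series M \<A>" "hconj f = f" "hconj g = g"
  shows "hi * (corr f g - corr g f) \<in> range hreal"
proof -
  have "corr f f + corr g g + hi * (corr f g - corr g f) \<in> range hreal" (is "?z \<in> _")
    using corr_complex_square[OF assms] by (auto simp: hle_def)
  moreover have "corr f f + corr g g \<in> range hreal"
    using assms by (intro hreal_range_closed(1) corr_self_real)
  ultimately have "?z - (corr f f + corr g g) \<in> range hreal"
    by (rule hreal_range_closed(2))
  then show ?thesis by simp
qed

lemma state_real:
  assumes "f \<in> smooth_series M \<A>" "hconj f = f"
  shows "\<rho> f \<in> range hreal"
proof -
  have "corr f (one_series M) + corr (one_series M) f \<in> range hreal"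
    by (rule corr_symmetric_real) (simp_all add: assms one_series_smooth hconj_one)
  then have "(\<rho> f + \<rho> f) / 2 \<in> range hreal"
    by (simp only: corr_one[OF assms(1)] hreal_range_closed(4))
  then show ?thesis by simp
qed

section \<open>The uncertainty relation\<close>

text \<open>Writing \<open>corr (F j) (F k) = a\<^sub>j\<^sub>k + i b\<^sub>j\<^sub>k\<close> with real series \<open>a\<close>, \<open>b\<close>, positivity at
  \<open>\<Sum>\<^sub>j (y\<^sub>j + i x\<^sub>j) F\<^sub>j\<close> is the hypothesis of \<open>det_le_of_form_bound\<close>.\<close>

lemma corr_det_le:
  assumes F: "\<And>j. j < n \<Longrightarrow> F j \<in> smooth_series M \<A>" and sa: "\<And>j. j < n \<Longrightarrow> hconj (F j) = F j"
  shows "det (mat n n (\<lambda>(j, k). - (hi * (corr (F j) (F k) - corr (F k) (F j)) / 2)))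
    \<preceq> det (mat n n (\<lambda>(j, k). (corr (F j) (F k) + corr (F k) (F j)) / 2))"
proof -
  define a where "a j k = inv_into UNIV hreal ((corr (F j) (F k) + corr (F k) (F j)) / 2)" for j k
  define b where "b j k = inv_into UNIV hreal (- (hi * (corr (F j) (F k) - corr (F k) (F j)) / 2))" for j k
  have a: "hreal (a j k) = (corr (F j) (F k) + corr (F k) (F j)) / 2" if "j < n" "k < n" for j k
    unfolding a_def
    by (intro f_inv_into_f hreal_range_closed corr_symmetric_real) (use that F sa in auto)
  have b: "hreal (b j k) = - (hi * (corr (F j) (F k) - corr (F k) (F j)) / 2)" if "j < n" "k < n" for j k
    unfolding b_def
    by (intro f_inv_into_f hreal_range_closed corr_skew_real) (use that F sa in auto)
  define A B where "A = mat n n (\<lambda>(j, k). a j k)" and "B = mat n n (\<lambda>(j, k). b j k)"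
  have form: "x \<bullet> (mat n n (\<lambda>(j, k). m j k) *\<^sub>v y) = (\<Sum>j<n. \<Sum>k<n. x $ j * m j k * y $ k)"
    if "x \<in> carrier_vec n" "y \<in> carrier_vec n" for x y and m :: "nat \<Rightarrow> nat \<Rightarrow> real hahn"
    using that by (auto simp: scalar_prod_def sum_distrib_left mult.assoc atLeast0LessThan
        intro!: sum.cong)
  have expand: "corr (comb c F n) (comb d F n) = (\<Sum>j<n. \<Sum>k<n. c j * corr (F j) (F k) * d k)"
    for c d by (rule corr_comb) (rule F)
  have sym: "corr (comb c F n) (comb c F n) = hreal (\<Sum>j<n. \<Sum>k<n. x j * a j k * x k)"
    if c: "c = (\<lambda>j. hreal (x j))" for c x
  proof -
    let ?s = "\<Sum>j<n. \<Sum>k<n. c j * corr (F j) (F k) * c k"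
    let ?t = "\<Sum>j<n. \<Sum>k<n. c j * corr (F k) (F j) * c k"
    have "?s = ?t" by (subst sum.swap) (simp only: ac_simps)
    then have "2 * ?s = ?s + ?t" by (simp only: mult_2)
    also have "\<dots> = (\<Sum>j<n. \<Sum>k<n. c j * (corr (F j) (F k) + corr (F k) (F j)) * c k)"
      by (simp only: sum.distrib distrib_left distrib_right)
    also have "\<dots> = (\<Sum>j<n. \<Sum>k<n. 2 * (c j * hreal (a j k) * c k))"
      by (intro sum.cong refl) (simp add: a)
    also have "\<dots> = 2 * hreal (\<Sum>j<n. \<Sum>k<n. x j * a j k * x k)"
      by (simp add: c sum_distrib_left hreal.hom_sum hreal.hom_mult)
    finally have "?s = hreal (\<Sum>j<n. \<Sum>k<n. x j * a j k * x k)" by simp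
    then show ?thesis using expand by simp
  qed
  have "det B \<le> det A"
  proof (rule det_le_of_form_bound)
    show "A \<in> carrier_mat n n" "B \<in> carrier_mat n n" by (simp_all add: A_def B_def)
    show "transpose_mat A = A"
      unfolding A_def by (intro eq_matI) (auto simp: a_def add.commute)
    fix x y :: "real hahn vec" assume x: "x \<in> carrier_vec n" and y: "y \<in> carrier_vec n"
    have hreal_double: "hreal (2 * z) = 2 * hreal z" for z by (simp only: mult_2 hreal.hom_add)
    define c d where "c = (\<lambda>j. hreal (x $ j))" and "d = (\<lambda>j. hreal (y $ j))"
    let ?u = "comb c F n" and ?v = "comb d F n"
    \<comment> \<open>The indices are exchanged so that both cross terms carry the coefficients \<open>y\<^sub>j x\<^sub>k\<close>.\<close>
    have swap: "corr ?u ?v = (\<Sum>j<n. \<Sum>k<n. d j * corr (F k) (F j) * c k)"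
      unfolding expand by (subst sum.swap) (simp only: ac_simps)
    have "hi * (corr ?v ?u - corr ?u ?v) =
        (\<Sum>j<n. \<Sum>k<n. d j * (hi * (corr (F j) (F k) - corr (F k) (F j))) * c k)"
      unfolding swap unfolding expand
      by (simp add: sum_distrib_left sum_subtractf[symmetric] algebra_simps)
    also have "\<dots> = (\<Sum>j<n. \<Sum>k<n. - 2 * (d j * hreal (b j k) * c k))"
      by (intro sum.cong refl) (simp add: b)
    also have "\<dots> = - 2 * hreal (y \<bullet> (B *\<^sub>v x))"
      by (simp add: B_def form x y c_def d_def sum_distrib_left hreal.hom_sum hreal.hom_mult)
    finally have cross: "hi * (corr ?v ?u - corr ?u ?v) = - 2 * hreal (y \<bullet> (B *\<^sub>v x))" .
    have "0 \<preceq> corr ?v ?v + corr ?u ?u + hi * (corr ?v ?u - corr ?u ?v)"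
      by (intro corr_complex_square comb_series hconj_comb) (use F sa in \<open>auto simp: c_def d_def\<close>)
    also have "corr ?v ?v + corr ?u ?u + hi * (corr ?v ?u - corr ?u ?v) =
        hreal (x \<bullet> (A *\<^sub>v x) + y \<bullet> (A *\<^sub>v y) - 2 * (y \<bullet> (B *\<^sub>v x)))"
      unfolding cross sym[OF c_def] sym[OF d_def]
      by (simp add: A_def form x y hreal.hom_add hreal.hom_minus hreal_double)
    finally show "2 * (y \<bullet> (B *\<^sub>v x)) \<le> x \<bullet> (A *\<^sub>v x) + y \<bullet> (A *\<^sub>v y)"
      by (simp add: hle_zero_hreal)
  qed
  then have "hreal (det B) \<preceq> hreal (det A)" by (auto simp: hle_def)
  moreover have "map_mat hreal A = mat n n (\<lambda>(j, k). (corr (F j) (F k) + corr (F k) (F j)) / 2)"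
    unfolding A_def by (intro eq_matI) (auto simp: a)
  moreover have "map_mat hreal B = mat n n (\<lambda>(j, k). - (hi * (corr (F j) (F k) - corr (F k) (F j)) / 2))"
    unfolding B_def by (intro eq_matI) (auto simp: b)
  ultimately show ?thesis by (metis hreal.hom_det)
qed

text \<open>The expectation of a self-adjoint element is real, so centring keeps it self-adjoint.\<close>

lemma centre:
  assumes X: "X \<in> smooth_series M \<A>" "hconj X = X"
  shows "X - \<rho> X \<bullet>\<^sub>h one_series M = (- \<rho> X) \<bullet>\<^sub>h one_series M + X"
    and "X - \<rho> X \<bullet>\<^sub>h one_series M \<in> smooth_series M \<A>"
    and "hconj (X - \<rho> X \<bullet>\<^sub>h one_series M) = X - \<rho> X \<bullet>\<^sub>h one_series M"
proof -
  show eq: "X - \<rho> X \<bullet>\<^sub>h one_series M = (- \<rho> X) \<bullet>\<^sub>h one_series M + X"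
    by (rule heval_eqI) simp
  show "X - \<rho> X \<bullet>\<^sub>h one_series M \<in> smooth_series M \<A>"
    unfolding eq by (intro add_series hscale_series one_series_smooth X)
  obtain r where r: "\<rho> X = hreal r" using state_real[OF X] by blast
  have "hcnj (- \<rho> X) = - \<rho> X"
    using hcnj_hreal[of "- r"] by (simp add: r hreal.hom_uminus)
  then show "hconj (X - \<rho> X \<bullet>\<^sub>h one_series M) = X - \<rho> X \<bullet>\<^sub>h one_series M"
    unfolding eq by (simp add: hconj_add hconj_hscale hconj_one X)
qed

text \<open>Scalars are central, so shifts by scalars do not change commutators.\<close>

lemma corr_centre_commutator:
  assumes X: "X \<in> smooth_series M \<A>" and Y: "Y \<in> smooth_series M \<A>"
  shows "corr (r \<bullet>\<^sub>h one_series M + X) (s \<bullet>\<^sub>h one_series M + Y) -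
      corr (s \<bullet>\<^sub>h one_series M + Y) (r \<bullet>\<^sub>h one_series M + X) = corr X Y - corr Y X"
proof -
  have "corr (r \<bullet>\<^sub>h one_series M + X) (s \<bullet>\<^sub>h one_series M + Y) =
      r * (s + \<rho> Y) + (s * \<rho> X + corr X Y)"
    if X: "X \<in> smooth_series M \<A>" and Y: "Y \<in> smooth_series M \<A>" for X Y r s
    using corr_linear(1)[OF one_series_smooth X, of "s \<bullet>\<^sub>h one_series M + Y" r]
      corr_linear(2)[OF one_series_smooth Y, of "one_series M" s]
      corr_linear(2)[OF one_series_smooth Y, of X s] X Y
    by (simp add: add_series hscale_series one_series_smooth corr_one state_one)
  from this[OF X Y, of r s] this[OF Y X, of s r] show ?thesis
    by (simp add: algebra_simps)
qed

lemma state_bracket: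
  assumes X: "X \<in> smooth_series M \<A>" and Y: "Y \<in> smooth_series M \<A>"
  shows "hbar / 2 * \<rho> (star_bracket star X Y) = - (hi * (corr X Y - corr Y X) / 2)"
proof -
  have bracket: "star_bracket star X Y =
      (1 / (hi * hbar)) \<bullet>\<^sub>h star X Y + ((- 1 / (hi * hbar)) \<bullet>\<^sub>h star Y X + 0)"
    unfolding star_bracket_def by (rule heval_eqI) (simp add: right_diff_distrib)
  have "\<rho> 0 = 0" using corr_one(1)[OF zero_series] corr_zero(2)[OF one_series_smooth] by simp
  then have "\<rho> (star_bracket star X Y) = 1 / (hi * hbar) * (corr X Y - corr Y X)"
    unfolding bracket corr_def
    using X Y by (simp add: state_linear star_closed add_series hscale_series zero_series del: add_0_right)
      (simp add: diff_divide_distrib)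
  then have "hbar / 2 * \<rho> (star_bracket star X Y) = 1 / hi * (corr X Y - corr Y X) / 2"
    using hbar_nonzero hi_nonzero by simp
  also have "1 / hi = - hi"
    using hi_squared hi_nonzero by (simp add: divide_eq_eq)
  finally show ?thesis by simp
qed

end

theorem mainTheorem3:
  fixes M :: "'m topology"
    and \<A> :: "('m, 'e::real_normed_vector) chart set"
    and \<omega> :: "('m, 'e) chart \<Rightarrow> 'm \<Rightarrow> 'e \<Rightarrow> 'e \<Rightarrow> real"
    and star :: "('m \<Rightarrow> complex) hahn \<Rightarrow> ('m \<Rightarrow> complex) hahn \<Rightarrow> ('m \<Rightarrow> complex) hahn"
    and \<rho> :: "('m \<Rightarrow> complex) hahn \<Rightarrow> complex hahn"
    and n :: nat
    and X \<delta>X :: "nat \<Rightarrow> ('m \<Rightarrow> complex) hahn"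
  assumes "symplectic_manifold M \<A> \<omega>"
    and "star_product M \<A> \<omega> star"
    and "star_state M \<A> star \<rho>"
    and "\<And>j. j < n \<Longrightarrow> X j \<in> smooth_series M \<A>"
    and "\<And>j. j < n \<Longrightarrow> hconj (X j) = X j"
    and "\<And>j. j < n \<Longrightarrow> \<delta>X j = X j - \<rho> (X j) \<bullet>\<^sub>h one_series M"
  shows "Determinant.det (Matrix.mat n n (\<lambda>(j, k). hbar / 2 * \<rho> (star_bracket star (X j) (X k))))
       \<preceq> Determinant.det (Matrix.mat n n (\<lambda>(j, k). 1 / 2 *
            \<rho> (star (\<delta>X j) (\<delta>X k) + star (\<delta>X k) (\<delta>X j))))"
proof -
  interpret symplectic_manifold M \<A> \<omega> by fact
  interpret star_state_space M \<A> \<omega> star \<rho> by unfold_locales fact+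
  note X = assms(4,5) and \<delta>X = assms(6)
  have smooth: "\<delta>X j \<in> smooth_series M \<A>" and sa: "hconj (\<delta>X j) = \<delta>X j" if "j < n" for j
    unfolding \<delta>X[OF that] using centre(2,3)[OF X[OF that]] by simp_all
  have commutator: "corr (\<delta>X j) (\<delta>X k) - corr (\<delta>X k) (\<delta>X j) = corr (X j) (X k) - corr (X k) (X j)"
    if "j < n" "k < n" for j k
    unfolding \<delta>X[OF that(1)] \<delta>X[OF that(2)] centre(1)[OF X[OF that(1)]] centre(1)[OF X[OF that(2)]]
    by (rule corr_centre_commutator) (use X that in auto)
  have "Matrix.mat n n (\<lambda>(j, k). hbar / 2 * \<rho> (star_bracket star (X j) (X k))) =
      mat n n (\<lambda>(j, k). - (hi * (corr (\<delta>X j) (\<delta>X k) - corr (\<delta>X k) (\<delta>X j)) / 2))"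
    by (rule cong_mat) (simp_all only: prod.case state_bracket X commutator)
  moreover have "Matrix.mat n n (\<lambda>(j, k). 1 / 2 * \<rho> (star (\<delta>X j) (\<delta>X k) + star (\<delta>X k) (\<delta>X j))) =
      mat n n (\<lambda>(j, k). (corr (\<delta>X j) (\<delta>X k) + corr (\<delta>X k) (\<delta>X j)) / 2)"
    by (rule cong_mat) (simp_all add: corr_def state_add star_closed smooth)
  ultimately show ?thesis using corr_det_le[of n \<delta>X] smooth sa by simp
qed

end
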